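(* Let $T$ be a non-star tree and let $x$ be a vertex of $T$ that is not a bad vertex of $T$. Then there exists a $(T,x)$-good 2-placement.
   Context: All graphs are finite, simple and undirected; $dist$ denotes distance in $T$ and $d(y)$ the degree of $y$ in $T$. A non-star tree is a tree not isomorphic to a star $K_{1,m}$ for any $m\ge0$. A vertex $x$ is a bad vertex of $T$ if $T$ is isomorphic to the path $P_5$ on five vertices and $x$ is its middle vertex. A permutation $\sigma$ of $V(T)$ is a 2-placement of $T$ if for every edge $ab\in E(T)$, $\sigma(a)\sigma(b)\notin E(T)$. $T^k$ is the $k$-th power of $T$; $\sigma(T)\subseteq T^k$ means that for every edge $ab$ of $T$, $dist(\sigma(a),\sigma(b))\le k$. A fixed-point-free permutation $\sigma$ of $V(T)$ is a $(T,x)$-good 2-placement if: (1) $\sigma$ is a 2-placement of $T$; (2) $\sigma(T)\subseteq T^5$; (3) $dist(x,\sigma(x))=1$; (4) $dist(y,\sigma(y))\le 2$ for every neighbor $y$ of $x$; (5) $dist(y,\sigma(y))\le 4$ for every $y$ with $d(y)=1$. *)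

theory Defs
  imports Main
begin

definition sgraph :: "'a set \<Rightarrow> ('a \<Rightarrow> 'a \<Rightarrow> bool) \<Rightarrow> bool" where
  "sgraph V E \<longleftrightarrow> finite V \<and> (\<forall>u v. E u v \<longrightarrow> u \<in> V \<and> v \<in> V)
     \<and> (\<forall>u v. E u v \<longrightarrow> E v u) \<and> (\<forall>u. \<not> E u u)"

definition is_walk :: "'a set \<Rightarrow> ('a \<Rightarrow> 'a \<Rightarrow> bool) \<Rightarrow> 'a list \<Rightarrow> bool" where
  "is_walk V E p \<longleftrightarrow> p \<noteq> [] \<and> set p \<subseteq> V \<and> (\<forall>i. Suc i < length p \<longrightarrow> E (p ! i) (p ! Suc i))"

definition connected_graph :: "'a set \<Rightarrow> ('a \<Rightarrow> 'a \<Rightarrow> bool) \<Rightarrow> bool" where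
  "connected_graph V E \<longleftrightarrow>
     (\<forall>u\<in>V. \<forall>v\<in>V. \<exists>p. is_walk V E p \<and> hd p = u \<and> last p = v)"

definition is_cycle :: "'a set \<Rightarrow> ('a \<Rightarrow> 'a \<Rightarrow> bool) \<Rightarrow> 'a list \<Rightarrow> bool" where
  "is_cycle V E p \<longleftrightarrow> is_walk V E p \<and> length p \<ge> 3 \<and> distinct p \<and> E (last p) (hd p)"

definition is_tree :: "'a set \<Rightarrow> ('a \<Rightarrow> 'a \<Rightarrow> bool) \<Rightarrow> bool" where
  "is_tree V E \<longleftrightarrow> sgraph V E \<and> V \<noteq> {} \<and> connected_graph V E \<and> (\<nexists>p. is_cycle V E p)"

definition gdist :: "'a set \<Rightarrow> ('a \<Rightarrow> 'a \<Rightarrow> bool) \<Rightarrow> 'a \<Rightarrow> 'a \<Rightarrow> nat" where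
  "gdist V E u v = (LEAST n. \<exists>p. is_walk V E p \<and> hd p = u \<and> last p = v \<and> length p = Suc n)"

definition degree :: "'a set \<Rightarrow> ('a \<Rightarrow> 'a \<Rightarrow> bool) \<Rightarrow> 'a \<Rightarrow> nat" where
  "degree V E v = card {w \<in> V. E v w}"

text \<open>(V,E) is isomorphic to a star K_{1,m} for some m \<ge> 0 (unfolded: a centre c adjacent
  to all other vertices, with every edge incident to c).\<close>
definition is_star :: "'a set \<Rightarrow> ('a \<Rightarrow> 'a \<Rightarrow> bool) \<Rightarrow> bool" where
  "is_star V E \<longleftrightarrow> (\<exists>c\<in>V. (\<forall>v\<in>V. v \<noteq> c \<longrightarrow> E c v) \<and> (\<forall>u v. E u v \<longrightarrow> u = c \<or> v = c))"

definition bad_vertex :: "'a set \<Rightarrow> ('a \<Rightarrow> 'a \<Rightarrow> bool) \<Rightarrow> 'a \<Rightarrow> bool" where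
  "bad_vertex V E x \<longleftrightarrow> (\<exists>f :: nat \<Rightarrow> 'a. bij_betw f {0..<5} V
      \<and> (\<forall>i\<in>{0..<5}. \<forall>j\<in>{0..<5}. E (f i) (f j) \<longleftrightarrow> (i = Suc j \<or> j = Suc i))
      \<and> x = f 2)"

definition two_placement :: "'a set \<Rightarrow> ('a \<Rightarrow> 'a \<Rightarrow> bool) \<Rightarrow> ('a \<Rightarrow> 'a) \<Rightarrow> bool" where
  "two_placement V E \<sigma> \<longleftrightarrow> bij_betw \<sigma> V V \<and> (\<forall>a b. E a b \<longrightarrow> \<not> E (\<sigma> a) (\<sigma> b))"

definition good_two_placement :: "'a set \<Rightarrow> ('a \<Rightarrow> 'a \<Rightarrow> bool) \<Rightarrow> 'a \<Rightarrow> ('a \<Rightarrow> 'a) \<Rightarrow> bool" where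
  "good_two_placement V E x \<sigma> \<longleftrightarrow>
     (\<forall>v\<in>V. \<sigma> v \<noteq> v)
   \<and> two_placement V E \<sigma>
   \<and> (\<forall>a b. E a b \<longrightarrow> gdist V E (\<sigma> a) (\<sigma> b) \<le> 5)
   \<and> gdist V E x (\<sigma> x) = 1
   \<and> (\<forall>y. E x y \<longrightarrow> gdist V E y (\<sigma> y) \<le> 2)
   \<and> (\<forall>y\<in>V. degree V E y = 1 \<longrightarrow> gdist V E y (\<sigma> y) \<le> 4)"

end

theory Submission
  imports Defs "HOL-Library.Multiset"
begin

text \<open>
  Root the tree at \<open>x\<close> and strengthen the claim: a good placement moves every vertex, not only
  the leaves, by at most 4. Argue by induction on the number of vertices. A set of branches at \<open>x\<close>, or
  at a child of \<open>x\<close>, that can be placed on its own vertices with its roots moving by at most 2 may be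
  removed: the edges joining it to the rest go to non-edges of span at most 5. By induction any
  branch that is not a star has this property, and so has any pair of leaves with a common
  neighbour, at any depth. Without such pairs of leaves the star branches are the paths with one, two
  or three vertices hung at an end, and any two of these can be removed together. What resists removal
  is a branch with root \<open>z\<close> below one of four small trees, where \<open>z\<close> and its parent exchange images,
  or one of finitely many small trees, which carry explicit placements.
\<close>

section \<open>Placements\<close>

text \<open>The constants fit together as sums. If a branch hangs at \<open>v\<close> and its root
  moves by at most 2, the image of that root is within 3 of \<open>v\<close>, and a span of 5 leaves
  2 for the move of \<open>v\<close>. Conditions (3) and (4) grant this at \<open>x\<close> and at
  its children, so general branches are removed only there. Two leaves that are swapped land within
  1 of their neighbour, which may then move by 4; asking 4 of every vertex makes this possible at
  any depth. Non-edges across a cut come for free: every edge between the two parts ends at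
  \<open>v\<close>, and \<open>v\<close> is not its own image.

  The obstacle is the remainder. Induction applies to it only if it is neither a star nor the path
  on five vertices rooted at its middle, so each case is a search for something to remove that
  avoids both. When no removal avoids them, the hinge relaxes the demands on the remainder: the
  edges at the parent of \<open>z\<close> may go anywhere nearby, because the parent gives its image
  away to \<open>z\<close>.\<close>

definition near :: "('a \<times> 'a) set \<Rightarrow> nat \<Rightarrow> 'a \<Rightarrow> 'a \<Rightarrow> bool" where
  "near E k u v \<longleftrightarrow> (u, v) \<in> (E\<^sup>=) ^^ k"

lemma near_refl [simp]: "near E k u u"
  by (induction k) (auto simp: near_def)

lemma near_add: "near E j u v \<Longrightarrow> near E k v w \<Longrightarrow> near E (j + k) u w"
  by (auto simp: near_def relpow_add)

lemma near_trans: "near E j u v \<Longrightarrow> near E k v w \<Longrightarrow> j + k \<le> n \<Longrightarrow> near E n u w"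
  by (metis near_add near_refl le_Suc_ex)

lemma near_mono:
  assumes "near E k u v" "E \<subseteq> F" "k \<le> n"
  shows "near F n u v"
proof -
  have "(E\<^sup>=) ^^ k \<subseteq> (F\<^sup>=) ^^ k"
    by (induction k) (use assms in \<open>auto intro!: relcomp_mono\<close>)
  then have "near F k u v" using assms by (auto simp: near_def)
  then show ?thesis using near_trans[of F k u v "n - k" v n] assms by simp
qed

lemma near_one: "near E (Suc 0) u v \<longleftrightarrow> u = v \<or> (u, v) \<in> E"
  by (auto simp: near_def)

lemma near_edge: "(u, v) \<in> E \<Longrightarrow> near E 1 u v"
  by (simp add: near_one)

lemma near_sym: "sym E \<Longrightarrow> near E k u v \<Longrightarrow> near E k v u"
proof -
  assume "sym E"
  then have s: "(u, v) \<in> E\<^sup>=" if "(v, u) \<in> E\<^sup>=" for u v using that by (auto simp: sym_def)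
  show "near E k u v \<Longrightarrow> near E k v u"
  proof (induction k arbitrary: v)
    case (Suc k)
    then obtain w where "(u, w) \<in> (E\<^sup>=) ^^ k" "(w, v) \<in> E\<^sup>=" by (auto simp: near_def)
    then have "(v, w) \<in> E\<^sup>=" "(w, u) \<in> (E\<^sup>=) ^^ k" using s Suc.IH[of w] by (simp_all add: near_def)
    then show ?case unfolding near_def by (rule relpow_Suc_I2)
  qed (simp add: near_def)
qed

lemma near_map: "near E k u v \<Longrightarrow> near (map_prod f f ` E) k (f u) (f v)"
proof (induction k arbitrary: v)
  case (Suc k)
  then obtain w where w: "near E k u w" "near E (Suc 0) w v"
    by (auto simp: near_def)
  then have "near (map_prod f f ` E) (Suc 0) (f w) (f v)" by (force simp: near_one)
  then show ?case
    using near_trans[OF Suc.IH[OF w(1)], of "Suc 0" "f v" "Suc k"] by simp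
qed (simp add: near_def)

text \<open>The vertices \<open>W\<close> are permuted and the edges \<open>D\<close> must go to non-edges of \<open>E\<close>. A triple
  \<open>(k, u, v)\<close> of \<open>N\<close> demands that the image of \<open>v\<close> lie within distance \<open>k\<close> of \<open>u\<close>.\<close>

definition places ::
  "('a \<times> 'a) set \<Rightarrow> 'a set \<Rightarrow> ('a \<times> 'a) set \<Rightarrow> (nat \<times> 'a \<times> 'a) set \<Rightarrow> ('a \<Rightarrow> 'a) \<Rightarrow> bool" where
  "places E W D N s \<longleftrightarrow> bij_betw s W W \<and> (\<forall>u\<in>W. s u \<noteq> u)
     \<and> (\<forall>a b. (a, b) \<in> D \<longrightarrow> (s a, s b) \<notin> E \<and> near E 5 (s a) (s b))
     \<and> (\<forall>k u v. (k, u, v) \<in> N \<longrightarrow> near E k u (s v))"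

text \<open>Carries a placement of a numbered tree over to any tree of the same shape. Injectivity
  is asked on all of \<open>V\<close>, since the image of a non-edge must not be hit by any other
  edge of \<open>E\<close>.\<close>

lemma places_map:
  assumes p: "places E W D N s" and f: "inj_on f V"
    and E: "E \<subseteq> V \<times> V" and W: "W \<subseteq> V" and D: "D \<subseteq> W \<times> W" and N: "\<And>k u v. (k, u, v) \<in> N \<Longrightarrow> v \<in> W"
  shows "\<exists>s'. places (map_prod f f ` E) (f ` W) (map_prod f f ` D)
    (map_prod id (map_prod f f) ` N) s'"
proof -
  define g where "g = the_inv_into W f"
  define s' where "s' = f \<circ> s \<circ> g"
  have fW: "inj_on f W" using f W by (rule inj_on_subset)
  have s'f: "s' (f u) = f (s u)" if "u \<in> W" for u
    using that fW by (simp add: s'_def g_def the_inv_into_f_f)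
  have b: "bij_betw s W W" using p by (simp add: places_def)
  have sW: "s u \<in> W" if "u \<in> W" for u using b that by (auto simp: bij_betw_def)
  have "bij_betw f W (f ` W)" using fW by (rule inj_on_imp_bij_betw)
  then have "bij_betw s' (f ` W) (f ` W)"
    unfolding s'_def g_def by (metis b bij_betw_trans bij_betw_the_inv_into)
  moreover have "s' u \<noteq> u" if "u \<in> f ` W" for u
    using that p fW by (auto simp: s'f places_def inj_on_def sW)
  moreover have "(s' a, s' b) \<notin> map_prod f f ` E \<and> near (map_prod f f ` E) 5 (s' a) (s' b)"
    if abD: "(a, b) \<in> map_prod f f ` D" for a b
  proof -
    obtain a' b' where ab: "a = f a'" "b = f b'" "(a', b') \<in> D" using abD by auto
    have w: "a' \<in> W" "b' \<in> W" using ab D by auto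
    have n: "(s a', s b') \<notin> E" "near E 5 (s a') (s b')" using p ab by (auto simp: places_def)
    have "(f (s a'), f (s b')) \<notin> map_prod f f ` E"
    proof
      assume "(f (s a'), f (s b')) \<in> map_prod f f ` E"
      then obtain u v where uv: "(u, v) \<in> E" "f u = f (s a')" "f v = f (s b')" by auto
      then have "u = s a'" "v = s b'"
        using E W inj_onD[OF f uv(2)] inj_onD[OF f uv(3)] sW[OF w(1)] sW[OF w(2)] by blast+
      then show False using n uv by simp
    qed
    then show ?thesis using near_map[OF n(2)] w by (simp add: ab s'f)
  qed
  moreover have "near (map_prod f f ` E) k u (s' v)"
    if kuv: "(k, u, v) \<in> map_prod id (map_prod f f) ` N" for k u v
  proof -
    obtain u' v' where *: "u = f u'" "v = f v'" "(k, u', v') \<in> N" using kuv by auto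
    then have "near E k u' (s v')" using p by (auto simp: places_def)
    then show ?thesis using near_map[of E k u' "s v'" f] N[OF *(3)] by (simp add: * s'f)
  qed
  ultimately have "places (map_prod f f ` E) (f ` W) (map_prod f f ` D) (map_prod id (map_prod f f) ` N) s'"
    unfolding places_def by (intro conjI allI impI ballI) meson+
  then show ?thesis by (rule exI[of _ s'])
qed

section \<open>Rooted trees and removable branches\<close>

datatype 'a rt = Node (root: 'a) (kids: "'a rt list")

text \<open>Lists rather than sets, so that concrete trees can be evaluated. The preorder also
  serves to match a tree with a numbered one.\<close>

fun labs :: "'a rt \<Rightarrow> 'a list" where
  "labs (Node x ts) = x # concat (map labs ts)"

fun elist :: "'a rt \<Rightarrow> ('a \<times> 'a) list" where
  "elist (Node x ts) = concat (map (\<lambda>t. (x, root t) # (root t, x) # elist t) ts)"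

abbreviation verts :: "'a rt \<Rightarrow> 'a set" where "verts t \<equiv> set (labs t)"
abbreviation edges :: "'a rt \<Rightarrow> ('a \<times> 'a) set" where "edges t \<equiv> set (elist t)"
abbreviation wf_rt :: "'a rt \<Rightarrow> bool" where "wf_rt t \<equiv> distinct (labs t)"

lemma root_in_verts [simp]: "root t \<in> verts t"
  by (cases t) simp

lemma edges_verts: "edges t \<subseteq> verts t \<times> verts t"
  by (induction t rule: labs.induct) fastforce

lemma sym_edges: "sym (edges t)"
  by (induction t rule: labs.induct) (fastforce simp: sym_def)

lemma labs_map: "labs (map_rt f t) = map f (labs t)"
  by (induction t rule: labs.induct) (simp add: map_concat comp_def cong: map_cong)

lemma root_map: "root (map_rt f t) = f (root t)"
  by (cases t) simp

lemma elist_map: "elist (map_rt f t) = map (map_prod f f) (elist t)"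
  by (induction t rule: labs.induct) (simp add: map_concat comp_def root_map cong: map_cong)

text \<open>Written as a set of triples so that \<open>places\<close> covers good placements,
  detachable branches and hinges alike.\<close>

definition good_dem :: "'a set \<Rightarrow> ('a \<times> 'a) set \<Rightarrow> 'a \<Rightarrow> (nat \<times> 'a \<times> 'a) set" where
  "good_dem V E x = (\<lambda>v. (4, v, v)) ` V \<union> {(1, x, x)} \<union> (\<lambda>(a, b). (2, b, b)) ` {e \<in> E. fst e = x}"

definition good :: "'a set \<Rightarrow> ('a \<times> 'a) set \<Rightarrow> 'a \<Rightarrow> bool" where
  "good V E x \<longleftrightarrow> (\<exists>s. places E V E (good_dem V E x) s)"

lemma good_iff:
  "places E V E (good_dem V E x) s \<longleftrightarrow> bij_betw s V V \<and> (\<forall>u\<in>V. s u \<noteq> u)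
     \<and> (\<forall>a b. (a, b) \<in> E \<longrightarrow> (s a, s b) \<notin> E \<and> near E 5 (s a) (s b))
     \<and> (\<forall>u\<in>V. near E 4 u (s u)) \<and> near E 1 x (s x) \<and> (\<forall>y. (x, y) \<in> E \<longrightarrow> near E 2 y (s y))"
proof -
  have "(k, u, v) \<in> good_dem V E x \<longleftrightarrow>
      k = 4 \<and> u = v \<and> u \<in> V \<or> k = 1 \<and> u = x \<and> v = x \<or> k = 2 \<and> u = v \<and> (x, u) \<in> E" for k u v
    by (auto simp: good_dem_def image_iff)
  then show ?thesis unfolding places_def by auto
qed

text \<open>The edges of \<open>D\<close> live on the new vertices \<open>W\<close>, and \<open>R\<close> is the set of new neighbours of
  \<open>v\<close>. The bound on \<open>m\<close> makes up for how far a good placement moves \<open>v\<close>.\<close>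

lemma good_attach:
  assumes g: "good V E x" and E: "E \<subseteq> V \<times> V" "sym E" and x: "x \<in> V" and v: "v \<in> V"
    and disj: "V \<inter> W = {}" and D: "D \<subseteq> W \<times> W" and R: "R \<subseteq> W"
    and F: "F = E \<union> D \<union> {v} \<times> R \<union> R \<times> {v}"
    and bij: "bij_betw t W W" and fp: "\<And>u. u \<in> W \<Longrightarrow> t u \<noteq> u"
    and n4: "\<And>u. u \<in> W \<Longrightarrow> near F 4 u (t u)"
    and tD: "\<And>a b. (a, b) \<in> D \<Longrightarrow> (t a, t b) \<notin> D \<and> near F 5 (t a) (t b)"
    and symD: "sym D"
    and tR: "\<And>r. r \<in> R \<Longrightarrow> near F m v (t r)" and m: "m \<le> 1 \<or> (m \<le> 3 \<and> (v = x \<or> (x, v) \<in> E))"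
    and tR2: "\<And>r. r \<in> R \<Longrightarrow> v = x \<Longrightarrow> near F 2 r (t r)"
  shows "good (V \<union> W) F x"
proof -
  obtain s where s: "places E V E (good_dem V E x) s" using g by (auto simp: good_def)
  note s = s[unfolded good_iff]
  define q where "q u = (if u \<in> V then s u else t u)" for u
  have qV: "q u = s u" if "u \<in> V" for u using that by (simp add: q_def)
  have qW: "q u = t u" if "u \<in> W" for u using that disj by (auto simp: q_def)
  have sV: "s u \<in> V" if "u \<in> V" for u using s that bij_betw_apply by metis
  have tW: "t u \<in> W" if "u \<in> W" for u using bij that bij_betw_apply by metis
  have EF: "E \<subseteq> F" "D \<subseteq> F" using F by auto
  have "sym ({v} \<times> R \<union> R \<times> {v})" by (auto simp: sym_def)
  from sym_Un[OF sym_Un[OF E(2) symD] this] have symF: "sym F" by (simp add: F Un_assoc)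
  have "bij_betw q V V" "bij_betw q W W"
    using s bij bij_betw_cong[of V q s V] bij_betw_cong[of W q t W] qV qW by simp_all
  then have b: "bij_betw q (V \<union> W) (V \<union> W)" using disj by (intro bij_betw_combine)
  obtain k where k: "near E k v (s v)" "k + m \<le> 5"
  proof (cases "m \<le> 1")
    case True
    then show ?thesis using that[of 4] s v by simp
  next
    case False
    show ?thesis
    proof (cases "v = x")
      case True
      then show ?thesis using that[of 1] s False m by simp
    next
      case F: False
      then show ?thesis using that[of 2] s False m by simp
    qed
  qed
  have FVV: "(a, b) \<in> F \<longleftrightarrow> (a, b) \<in> E" if "a \<in> V" "b \<in> V" for a b
    using that F D R disj by blast
  have FWW: "(a, b) \<in> F \<longleftrightarrow> (a, b) \<in> D" if "a \<in> W" "b \<in> W" for a b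
    using that F E v disj by blast
  have FVW: "(a, b) \<in> F \<longleftrightarrow> a = v \<and> b \<in> R" if "a \<in> V" "b \<in> W" for a b
    using that F E D R disj by blast
  \<comment> \<open>The images lie in different parts, and \<open>v\<close> is the only vertex of
    \<open>V\<close> with neighbours in \<open>W\<close>; it is not the image of itself.\<close>
  have vR: "(q v, q r) \<notin> F \<and> near F 5 (q v) (q r)" if r: "r \<in> R" for r
  proof -
    have rW: "r \<in> W" using r R by blast
    have "near F k (s v) v" using near_sym[OF symF near_mono[OF k(1) EF(1) order_refl]] .
    then have "near F 5 (s v) (t r)" using near_trans[OF _ tR[OF r] k(2)] by simp
    moreover have "s v \<noteq> v" using s v by blast
    ultimately show ?thesis
      using FVW[OF sV[OF v] tW[OF rW]] qV[OF v] qW[OF rW] by simp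
  qed
  have e: "(q a, q b) \<notin> F \<and> near F 5 (q a) (q b)" if ab: "(a, b) \<in> F" for a b
  proof -
    consider "(a, b) \<in> E" | "(a, b) \<in> D" | "a = v" "b \<in> R" | "b = v" "a \<in> R" using ab F by blast
    then show ?thesis
    proof cases
      case 1
      then have ab: "a \<in> V" "b \<in> V" using E by blast+
      moreover have "(s a, s b) \<notin> E" "near E 5 (s a) (s b)" using s 1 by blast+
      ultimately show ?thesis using FVV[OF sV[OF ab(1)] sV[OF ab(2)]] near_mono[OF _ EF(1) order_refl]
        by (simp add: qV)
    next
      case 2
      then have ab: "a \<in> W" "b \<in> W" using D by blast+
      then show ?thesis using tD[OF 2] FWW[OF tW[OF ab(1)] tW[OF ab(2)]] by (simp add: qW)
    next
      case 3
      then show ?thesis using vR by blast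
    next
      case 4
      then show ?thesis using vR[of a] near_sym[OF symF, of 5 "q b" "q a"] symE[OF symF, of "q a" "q b"]
        by blast
    qed
  qed
  have n2: "near F 2 y (q y)" if "(x, y) \<in> F" for y
  proof -
    consider "(x, y) \<in> E" | "x = v" "y \<in> R"
    proof -
      have "y \<in> V \<or> y \<in> W" using \<open>(x, y) \<in> F\<close> E(1) D R v unfolding F by blast
      then show ?thesis using FVV[OF x, of y] FVW[OF x, of y] that(1) \<open>(x, y) \<in> F\<close> that by blast
    qed
    then show ?thesis
    proof cases
      case 1
      then have "y \<in> V" using E by blast
      then show ?thesis using s 1 near_mono[OF _ EF(1) order_refl] by (simp add: qV)
    next
      case 2
      then have "y \<in> W" using R by blast
      then show ?thesis using tR2 2 by (simp add: qW)
    qed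
  qed
  have n4': "q u \<noteq> u \<and> near F 4 u (q u)" if "u \<in> V \<union> W" for u
  proof (cases "u \<in> V")
    case True
    then show ?thesis using s near_mono[OF _ EF(1) order_refl] by (simp add: qV)
  next
    case False
    then have "u \<in> W" using that by blast
    then show ?thesis using fp n4 by (simp add: qW)
  qed
  have n1: "near F 1 x (q x)" using s near_mono[OF _ EF(1) order_refl] x by (simp add: qV)
  have "places F (V \<union> W) F (good_dem (V \<union> W) F x) q"
    unfolding good_iff using b e n1 n2 n4' by blast
  then show ?thesis by (auto simp: good_def)
qed

abbreviation good_rt :: "'a rt \<Rightarrow> bool" where
  "good_rt t \<equiv> good (verts t) (edges t) (root t)"

section \<open>Detachable branches\<close>

definition floating_dem :: "'a rt list \<Rightarrow> (nat \<times> 'a \<times> 'a) list" where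
  "floating_dem ts = map (\<lambda>u. (4, u, u)) (concat (map labs ts)) @ map (\<lambda>t. (2, root t, root t)) ts"

text \<open>The vertex \<open>v\<close> is not moved, but its edges count for distances, so that
  images may pass from one branch to another through \<open>v\<close>.\<close>

definition floating :: "'a \<Rightarrow> 'a rt list \<Rightarrow> bool" where
  "floating v ts \<longleftrightarrow> (\<exists>s. places (edges (Node v ts)) (set (concat (map labs ts)))
     (set (concat (map elist ts))) (set (floating_dem ts)) s)"

lemma places_edge:
  assumes "places E W D N s" "(a, b) \<in> D"
  shows "(s a, s b) \<notin> E" "near E 5 (s a) (s b)"
  using assms by (auto simp: places_def)

lemma places_near: "places E W D N s \<Longrightarrow> (k, u, v) \<in> N \<Longrightarrow> near E k u (s v)"
  by (auto simp: places_def)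

lemma places_in: "places E W D N s \<Longrightarrow> u \<in> W \<Longrightarrow> s u \<in> W"
  by (auto simp: places_def dest: bij_betw_apply)

text \<open>The bound 3 passed as \<open>m\<close> is one step from \<open>v\<close> to a root and
  the move of at most 2 of that root. When \<open>v\<close> is \<open>x\<close>, the roots become
  neighbours of \<open>x\<close>, whose own bound is this same 2.\<close>

lemma floating_attach:
  assumes f: "floating v ts" and g: "good V E x" and E: "E \<subseteq> V \<times> V" "sym E" and x: "x \<in> V"
    and v: "v = x \<or> (x, v) \<in> E" and disj: "V \<inter> set (concat (map labs ts)) = {}"
    and F: "F = E \<union> edges (Node v ts)"
    and V': "V' = V \<union> set (concat (map labs ts))"
  shows "good V' F x"
proof -
  define W where "W = set (concat (map labs ts))"
  define D where "D = set (concat (map elist ts))"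
  define R where "R = root ` set ts"
  have ev: "edges (Node v ts) = D \<union> {v} \<times> R \<union> R \<times> {v}"
    by (auto simp: D_def R_def)
  obtain s where s: "places (edges (Node v ts)) W D (set (floating_dem ts)) s"
    using f by (auto simp: floating_def W_def D_def)
  have vV: "v \<in> V" using v x E by blast
  have DW: "D \<subseteq> W \<times> W" using edges_verts by (fastforce simp: D_def W_def)
  have RW: "R \<subseteq> W" by (force simp: R_def W_def)
  have sD: "sym D" using sym_edges by (fastforce simp: D_def sym_def)
  have eF: "edges (Node v ts) \<subseteq> F" using F by blast
  have nF: "near F n u (s w)" if "(k, u, w) \<in> set (floating_dem ts)" "k \<le> n" for k n u w
    using near_mono[OF places_near[OF s that(1)] eF that(2)] .
  have R2: "near F 2 r (s r)" if "r \<in> R" for r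
    by (rule nF[of 2]) (use that in \<open>auto simp: R_def floating_dem_def\<close>)
  show ?thesis
    unfolding V' W_def[symmetric]
  proof (rule good_attach[OF g E x vV, where R = R and D = D and t = s and m = 3])
    show "V \<inter> W = {}" using disj by (simp add: W_def)
    show "D \<subseteq> W \<times> W" "R \<subseteq> W" "sym D" by fact+
    show "F = E \<union> D \<union> {v} \<times> R \<union> R \<times> {v}" using F ev by blast
    show "bij_betw s W W" using s by (simp add: places_def)
    show "s u \<noteq> u" if "u \<in> W" for u using s that by (simp add: places_def)
    show "near F 4 u (s u)" if "u \<in> W" for u
      by (rule nF[of 4]) (use that in \<open>auto simp: W_def floating_dem_def\<close>)
    show "(s a, s b) \<notin> D \<and> near F 5 (s a) (s b)" if "(a, b) \<in> D" for a b
      using places_edge[OF s that] near_mono[OF _ eF order_refl] ev by blast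
    show "near F 3 v (s r)" if "r \<in> R" for r
    proof -
      have "near F 1 v r" using that F ev by (intro near_edge) blast
      from near_trans[OF this R2[OF that]] show ?thesis by simp
    qed
    show "3 \<le> (1::nat) \<or> (3::nat) \<le> 3 \<and> (v = x \<or> (x, v) \<in> E)" using v by simp
    show "near F 2 r (s r)" if "r \<in> R" for r using R2 that .
  qed
qed

lemma floating_root:
  assumes "floating x ts" "good_rt (Node x us)" "wf_rt (Node x (ts @ us))"
  shows "good_rt (Node x (ts @ us))"
  using floating_attach[OF assms(1,2) edges_verts sym_edges root_in_verts,
      where V' = "verts (Node x (ts @ us))" and F = "edges (Node x (ts @ us))"]
    assms(3) by (auto simp: Un_ac)

lemma floating_child:
  assumes "floating g ts" "good_rt (Node x (Node g us # rest))" "wf_rt (Node x (Node g (ts @ us) # rest))"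
  shows "good_rt (Node x (Node g (ts @ us) # rest))"
  using floating_attach[OF assms(1,2) edges_verts sym_edges root_in_verts,
      where V' = "verts (Node x (Node g (ts @ us) # rest))" and F = "edges (Node x (Node g (ts @ us) # rest))"]
    assms(3) by (auto simp: Un_ac insert_commute Int_commute)

text \<open>A good placement moves the root by at most 1, within the 2 that is allowed. The
  additional edges all end at \<open>v\<close>, which is no image.\<close>

lemma floating_single:
  assumes g: "good_rt t" and w: "wf_rt (Node v [t])"
  shows "floating v [t]"
proof -
  obtain s where s: "places (edges t) (verts t) (edges t) (good_dem (verts t) (edges t) (root t)) s"
    using g by (auto simp: good_def)
  have F: "edges t \<subseteq> edges (Node v [t])" by auto
  note mono = near_mono[OF _ F]
  have "places (edges (Node v [t])) (verts t) (edges t) (set (floating_dem [t])) s"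
    unfolding places_def
  proof (intro conjI allI impI ballI)
    show "bij_betw s (verts t) (verts t)" using s by (simp add: places_def)
    show "s u \<noteq> u" if "u \<in> verts t" for u using s that by (simp add: places_def)
    show "near (edges (Node v [t])) 5 (s a) (s b)" if "(a, b) \<in> edges t" for a b
      using mono[OF places_edge(2)[OF s that]] by simp
    show "(s a, s b) \<notin> edges (Node v [t])" if "(a, b) \<in> edges t" for a b
    proof -
      have "s a \<in> verts t" "s b \<in> verts t" using that edges_verts[of t] places_in[OF s] by blast+
      then show ?thesis using places_edge(1)[OF s that] w by auto
    qed
    show "near (edges (Node v [t])) k u (s w)" if kuw: "(k, u, w) \<in> set (floating_dem [t])" for k u w
    proof -
      consider "k = 4" "w = u" "u \<in> verts t" | "k = 2" "w = u" "u = root t"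
        using kuw by (auto simp: floating_dem_def)
      then show ?thesis
      proof cases
        case 1
        then show ?thesis using s[unfolded good_iff] mono[of 4] by blast
      next
        case 2
        then show ?thesis using s[unfolded good_iff] mono[of 1 _ _ 2] by simp
      qed
    qed
  qed
  then show ?thesis by (auto simp: floating_def)
qed

text \<open>A permutation of the small tree in which \<open>g\<close> stands for itself followed by a new branch: its
  image must be a neighbour, and the images of its neighbours must be within 3 of \<open>g\<close>.\<close>

definition hinge_dem :: "'a set \<Rightarrow> ('a \<times> 'a) set \<Rightarrow> 'a \<Rightarrow> 'a \<Rightarrow> (nat \<times> 'a \<times> 'a) set" where
  "hinge_dem V E x g = (\<lambda>v. (4, v, v)) ` {v \<in> V. v \<noteq> g} \<union> {(1, x, x), (1, g, g)}
     \<union> (\<lambda>(a, b). (2, b, b)) ` {e \<in> E. fst e = x \<and> snd e \<noteq> g} \<union> (\<lambda>(a, b). (3, a, b)) ` {e \<in> E. fst e = g}"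

definition hinged :: "'a set \<Rightarrow> ('a \<times> 'a) set \<Rightarrow> 'a \<Rightarrow> 'a \<Rightarrow> bool" where
  "hinged V E x g \<longleftrightarrow> (\<exists>s. places E V {e \<in> E. fst e \<noteq> g \<and> snd e \<noteq> g} (hinge_dem V E x g) s)"

text \<open>The new branch is hooked into the cycle of \<open>g\<close>: \<open>g\<close> takes over the image of \<open>z\<close>, and \<open>z\<close>
  that of \<open>g\<close>.\<close>

lemma hinged_attach:
  assumes h: "hinged V E x g" and gz: "good V' E' z"
    and E: "E \<subseteq> V \<times> V" "sym E" and E': "E' \<subseteq> V' \<times> V'" "sym E'"
    and x: "x \<in> V" and g: "g \<in> V" and z: "z \<in> V'" and xg: "x \<noteq> g" and disj: "V \<inter> V' = {}"
    and irr: "\<And>u. (u, u) \<notin> E" "\<And>u. (u, u) \<notin> E'"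
    and F: "F = E \<union> E' \<union> {(g, z), (z, g)}"
  shows "good (V \<union> V') F x"
proof -
  obtain s where s: "places E V {e \<in> E. fst e \<noteq> g \<and> snd e \<noteq> g} (hinge_dem V E x g) s"
    using h by (auto simp: hinged_def)
  obtain r where r: "places E' V' E' (good_dem V' E' z) r" using gz by (auto simp: good_def)
  note r' = r[unfolded good_iff]
  define q where "q u = (if u = g then r z else if u = z then s g else if u \<in> V then s u else r u)" for u
  have zg: "z \<noteq> g" using g z disj by blast
  have zV: "z \<notin> V" and gV': "g \<notin> V'" using g z disj by blast+
  have qg: "q g = r z" and qz: "q z = s g" using zg by (simp_all add: q_def)
  have qV: "q u = s u" if "u \<in> V" "u \<noteq> g" for u using that zV by (auto simp: q_def)
  have qV': "q u = r u" if "u \<in> V'" "u \<noteq> z" for u using that gV' disj by (auto simp: q_def)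
  have sV: "s u \<in> V" if "u \<in> V" for u using places_in[OF s that] .
  have rV: "r u \<in> V'" if "u \<in> V'" for u using places_in[OF r that] .
  have EF: "E \<subseteq> F" "E' \<subseteq> F" using F by auto
  have "sym {(g, z), (z, g)}" by (auto simp: sym_def)
  from sym_Un[OF sym_Un[OF E(2) E'(2)] this] have symF: "sym F" by (simp add: F)
  have sn: "near F k u (s v)" if "(k, u, v) \<in> hinge_dem V E x g" for k u v
    using near_mono[OF places_near[OF s that] EF(1) order_refl] .
  have rn: "near F k u v" if "near E' k u v" for k u v
    using near_mono[OF that EF(2) order_refl] .
  have fps: "s u \<noteq> u" if "u \<in> V" for u using s that by (simp add: places_def)
  have fpr: "r u \<noteq> u" if "u \<in> V'" for u using r that by (simp add: places_def)
  have pg: "near F 1 g (s g)" by (rule sn) (simp add: hinge_dem_def)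
  have gz1: "near F 1 g z" using F by (intro near_edge) blast
  have zr1: "near F 1 z (r z)" using r' rn by blast
  have FVV: "(a, b) \<in> F \<longleftrightarrow> (a, b) \<in> E" if "a \<in> V" "b \<in> V" for a b
    using that E' disj zV unfolding F by auto
  have FWW: "(a, b) \<in> F \<longleftrightarrow> (a, b) \<in> E'" if "a \<in> V'" "b \<in> V'" for a b
    using that E disj gV' unfolding F by auto
  have FVW: "(a, b) \<in> F \<longleftrightarrow> a = g \<and> b = z" if "a \<in> V" "b \<in> V'" for a b
    using that E E' disj zV gV' unfolding F by auto
  have FWV: "(b, a) \<in> F \<longleftrightarrow> a = g \<and> b = z" if "a \<in> V" "b \<in> V'" for a b
    using FVW[OF that] symF by (auto dest: symD)
  \<comment> \<open>\<open>q\<close> is the union of the two given permutations after the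
    transposition of \<open>g\<close> and \<open>z\<close>, hence a bijection.\<close>
  define c where "c u = (if u \<in> V then s u else r u)" for u
  define w where "w = id(g := z, z := g)"
  have "q = c \<circ> w" using zg g z zV gV' by (auto simp: fun_eq_iff q_def c_def w_def)
  moreover have "c u = r u" if "u \<in> V'" for u using that disj by (auto simp: c_def)
  then have "bij_betw c V V" "bij_betw c V' V'"
    using s r' bij_betw_cong[of V c s V] bij_betw_cong[of V' c r V']
    by (simp_all add: places_def c_def)
  then have "bij_betw c (V \<union> V') (V \<union> V')" using disj by (intro bij_betw_combine)
  moreover have "bij_betw w (V \<union> V') (V \<union> V')"
    by (rule bij_betw_byWitness[where f' = w]) (use g z zg in \<open>auto simp: w_def\<close>)
  ultimately have b: "bij_betw q (V \<union> V') (V \<union> V')" using bij_betw_trans by blast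
  have mv: "q u \<noteq> u \<and> near F 4 u (q u)" if u: "u \<in> V \<union> V'" for u
  proof -
    consider "u = g" | "u = z" | "u \<in> V" "u \<noteq> g" | "u \<in> V'" "u \<noteq> z" using u by blast
    then show ?thesis
    proof cases
      case 1
      then show ?thesis using qg rV[OF z] gV' near_trans[OF gz1 zr1, of 4] by auto
    next
      case 2
      then show ?thesis
        using qz sV[OF g] zV near_trans[OF near_sym[OF symF gz1] pg, of 4] by auto
    next
      case 3
      then show ?thesis using qV fps sn[of 4 u u] by (auto simp: hinge_dem_def)
    next
      case 4
      then show ?thesis using qV' fpr rn[of 4 u "r u"] r' by auto
    qed
  qed
  \<comment> \<open>The new image \<open>r z\<close> of \<open>g\<close> is within 2 of
    \<open>g\<close> by way of \<open>z\<close>, so 3 remains for \<open>s b\<close>; this is the 3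
    of \<open>hinge_dem\<close>. The only edge between the parts ends at \<open>z\<close>, which
    differs from \<open>r z\<close>.\<close>
  have gb: "(q g, q b) \<notin> F \<and> near F 5 (q g) (q b)" if b: "(g, b) \<in> E" for b
  proof -
    have bV: "b \<in> V" "b \<noteq> g" using b E irr by blast+
    have "near F 3 g (s b)" by (rule sn) (use b in \<open>force simp: hinge_dem_def\<close>)
    moreover have "near F 2 (r z) g"
      using near_sym[OF symF] near_trans[OF gz1 zr1, of 2] by simp
    ultimately have "near F 5 (r z) (s b)" using near_trans by fastforce
    moreover have "(r z, s b) \<notin> F" using FWV[OF sV[OF bV(1)] rV[OF z]] fpr[OF z] by simp
    ultimately show ?thesis by (simp add: qg qV[OF bV])
  qed
  \<comment> \<open>Both are measured from \<open>z\<close>: \<open>s g\<close> is within 2 by way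
    of \<open>g\<close>, and \<open>r u\<close> within 3 because the neighbour \<open>u\<close> of
    the root \<open>z\<close> moves by at most 2.\<close>
  have zu: "(q z, q u) \<notin> F \<and> near F 5 (q z) (q u)" if u: "(z, u) \<in> E'" for u
  proof -
    have uV: "u \<in> V'" "u \<noteq> z" using u E' irr by blast+
    have "near F 2 u (r u)" using r' u rn by blast
    moreover have "near F 1 z u" using u EF by (intro near_edge) blast
    ultimately have "near F 3 z (r u)" using near_trans by fastforce
    moreover have "near F 2 (s g) z"
      using near_trans[OF near_sym[OF symF pg] gz1, of 2] by simp
    ultimately have "near F 5 (s g) (r u)" using near_trans by fastforce
    moreover have "(s g, r u) \<notin> F" using FVW[OF sV[OF g] rV[OF uV(1)]] fps[OF g] by simp
    ultimately show ?thesis by (simp add: qz qV'[OF uV])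
  qed
  have gzF: "(q g, q z) \<notin> F \<and> near F 5 (q g) (q z)"
  proof -
    have "near F 2 g (r z)" using near_trans[OF gz1 zr1, of 2] by simp
    then have "near F 5 (s g) (r z)" using near_trans[OF near_sym[OF symF pg], of 2 "r z" 5] by simp
    moreover have "(r z, s g) \<notin> F" using FWV[OF sV[OF g] rV[OF z]] fpr[OF z] by simp
    ultimately show ?thesis using near_sym[OF symF] by (simp add: qg qz)
  qed
  have swap: "(q b, q a) \<notin> F \<and> near F 5 (q b) (q a)" if "(q a, q b) \<notin> F \<and> near F 5 (q a) (q b)" for a b
    using that near_sym[OF symF, of 5 "q a" "q b"] symD[OF symF, of "q b" "q a"] by blast
  have e: "(q a, q b) \<notin> F \<and> near F 5 (q a) (q b)" if ab: "(a, b) \<in> F" for a b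
  proof -
    consider "(a, b) \<in> E" "a \<noteq> g" "b \<noteq> g" | "(a, b) \<in> E" "a = g" | "(b, a) \<in> E" "b = g"
      | "(a, b) \<in> E'" "a \<noteq> z" "b \<noteq> z" | "(a, b) \<in> E'" "a = z" | "(b, a) \<in> E'" "b = z"
      | "a = g" "b = z" | "a = z" "b = g"
      using ab symD[OF E(2), of a b] symD[OF E'(2), of a b] unfolding F by blast
    then show ?thesis
    proof cases
      case 1
      then have abV: "a \<in> V" "b \<in> V" using E by blast+
      have "(a, b) \<in> {e \<in> E. fst e \<noteq> g \<and> snd e \<noteq> g}" using 1 by simp
      from places_edge[OF s this] show ?thesis
        using FVV[OF sV[OF abV(1)] sV[OF abV(2)]] near_mono[OF _ EF(1) order_refl] 1 abV
        by (simp add: qV)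
    next
      case 4
      then have abV: "a \<in> V'" "b \<in> V'" using E' by blast+
      from places_edge[OF r 4(1)] show ?thesis
        using FWW[OF rV[OF abV(1)] rV[OF abV(2)]] near_mono[OF _ EF(2) order_refl] 4 abV
        by (simp add: qV')
    next
      case 2
      then show ?thesis using gb[of b] by simp
    next
      case 3
      then show ?thesis using swap[OF gb[of a]] by simp
    next
      case 5
      then show ?thesis using zu[of b] by simp
    next
      case 6
      then show ?thesis using swap[OF zu[of a]] by simp
    next
      case 7
      then show ?thesis using gzF by simp
    next
      case 8
      then show ?thesis using swap[OF gzF] by simp
    qed
  qed
  have n1: "near F 1 x (q x)" using sn[of 1 x x] qV[OF x xg] by (simp add: hinge_dem_def)
  have n2: "near F 2 y (q y)" if y: "(x, y) \<in> F" for y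
  proof (cases "y = g")
    case True
    then show ?thesis using near_trans[OF gz1 zr1, of 2] by (simp add: qg)
  next
    case False
    have "(x, y) \<in> E" using y E' x disj xg zV unfolding F by auto
    moreover then have "y \<in> V" using E by blast
    moreover have "near F 2 y (s y)"
      by (rule sn) (use calculation False in \<open>force simp: hinge_dem_def\<close>)
    ultimately show ?thesis using qV False by simp
  qed
  have "places F (V \<union> V') F (good_dem (V \<union> V') F x) q"
    unfolding good_iff using b e n1 n2 mv by blast
  then show ?thesis by (auto simp: good_def)
qed

section \<open>Checking concrete placements\<close>

fun nearb :: "('a \<times> 'a) list \<Rightarrow> nat \<Rightarrow> 'a \<Rightarrow> 'a \<Rightarrow> bool" where
  "nearb el 0 u v \<longleftrightarrow> u = v"
| "nearb el (Suc k) u v \<longleftrightarrow> u = v \<or> list_ex (\<lambda>(a, b). a = u \<and> nearb el k b v) el"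

lemma nearb_near: "nearb el k u v \<Longrightarrow> near (set el) k u v"
proof (induction k arbitrary: u)
  case (Suc k)
  then consider "u = v" | w where "(u, w) \<in> set el" "near (set el) k w v"
    by (auto simp: list_ex_iff)
  then show ?case
  proof cases
    case 2
    then show ?thesis using near_trans[OF near_edge[OF 2(1)] 2(2), of "Suc k"] by simp
  qed simp
qed simp

definition places_check ::
  "('a \<times> 'a) list \<Rightarrow> 'a list \<Rightarrow> ('a \<times> 'a) list \<Rightarrow> (nat \<times> 'a \<times> 'a) list \<Rightarrow> ('a \<Rightarrow> 'a) \<Rightarrow> bool" where
  "places_check el W D N s \<longleftrightarrow> distinct (map s W)
     \<and> list_all (\<lambda>u. s u \<in> set W \<and> s u \<noteq> u) W
     \<and> list_all (\<lambda>(a, b). (s a, s b) \<notin> set el \<and> nearb el 5 (s a) (s b)) D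
     \<and> list_all (\<lambda>(k, u, v). nearb el k u (s v)) N"

lemma places_check:
  assumes "places_check el W D N s"
  shows "places (set el) (set W) (set D) (set N) s"
proof -
  have "inj_on s (set W)" "s ` set W \<subseteq> set W"
    using assms by (auto simp: places_check_def distinct_map list_all_iff)
  then have "bij_betw s (set W) (set W)" by (simp add: bij_betw_def endo_inj_surj)
  then show ?thesis
    using assms by (force simp: places_check_def places_def list_all_iff intro: nearb_near)
qed

definition good_check :: "nat rt \<Rightarrow> nat list \<Rightarrow> bool" where
  "good_check c p \<longleftrightarrow> places_check (elist c) (labs c) (elist c)
     (map (\<lambda>v. (4, v, v)) (labs c) @ (1, root c, root c)
       # map (\<lambda>(a, b). (2, b, b)) (filter (\<lambda>e. fst e = root c) (elist c))) ((!) p)"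

text \<open>Only the branches are permuted. In the table, entry 0 of \<open>p\<close> belongs to the
  root and is padding that keeps positions equal to labels.\<close>

definition floating_check :: "nat rt \<Rightarrow> nat list \<Rightarrow> bool" where
  "floating_check c p \<longleftrightarrow> places_check (elist c) (concat (map labs (kids c)))
     (concat (map elist (kids c))) (floating_dem (kids c)) ((!) p)"

definition hinged_check :: "nat rt \<Rightarrow> nat \<Rightarrow> nat list \<Rightarrow> bool" where
  "hinged_check c g p \<longleftrightarrow> places_check (elist c) (labs c)
     (filter (\<lambda>e. fst e \<noteq> g \<and> snd e \<noteq> g) (elist c))
     (map (\<lambda>v. (4, v, v)) (filter (\<lambda>v. v \<noteq> g) (labs c)) @ [(1, root c, root c), (1, g, g)]
       @ map (\<lambda>(a, b). (2, b, b)) (filter (\<lambda>e. fst e = root c \<and> snd e \<noteq> g) (elist c))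
       @ map (\<lambda>(a, b). (3, a, b)) (filter (\<lambda>e. fst e = g) (elist c))) ((!) p)"

text \<open>A tree \<open>c\<close> numbered in preorder is turned into \<open>t\<close> by reading
  off positions in the label list of \<open>t\<close>, so no separate isomorphism has to be
  supplied.\<close>

lemma nth_labs:
  assumes "labs c = [0..<length (labs t)]" "wf_rt t" "map_rt ((!) (labs t)) c = t"
  shows "inj_on ((!) (labs t)) (verts c)" "verts t = (!) (labs t) ` verts c"
    "edges t = map_prod ((!) (labs t)) ((!) (labs t)) ` edges c" "root t = labs t ! root c"
proof -
  show "inj_on ((!) (labs t)) (verts c)" using assms(1,2) by (simp add: inj_on_nth)
  define f where "f = (!) (labs t)"
  have t: "t = map_rt f c" using assms(3) by (simp add: f_def)
  show "verts t = (!) (labs t) ` verts c" unfolding f_def[symmetric] by (simp add: t labs_map)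
  show "edges t = map_prod ((!) (labs t)) ((!) (labs t)) ` edges c"
    unfolding f_def[symmetric] by (simp add: t elist_map)
  show "root t = labs t ! root c" unfolding f_def[symmetric] by (simp add: t root_map)
qed

lemma good_by_check:
  assumes "good_check c p" and t: "labs c = [0..<length (labs t)]" "wf_rt t" "map_rt ((!) (labs t)) c = t"
  shows "good_rt t"
proof -
  define f where "f = (!) (labs t)"
  note ft = nth_labs[OF t, folded f_def]
  define N where "N = set (map (\<lambda>v. (4::nat, v, v)) (labs c) @ (1, root c, root c)
       # map (\<lambda>(a, b). (2, b, b)) (filter (\<lambda>e. fst e = root c) (elist c)))"
  have "places (edges c) (verts c) (edges c) N ((!) p)"
    using assms(1) by (auto simp: good_check_def N_def dest: places_check)
  moreover have "v \<in> verts c" if "(k, u, v) \<in> N" for k u v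
    using that edges_verts[of c] by (auto simp: N_def)
  ultimately obtain s where s: "places (edges t) (verts t) (edges t) (map_prod id (map_prod f f) ` N) s"
    using places_map[OF _ ft(1) edges_verts order_refl edges_verts] ft by metis
  have "map_prod id (map_prod f f) ` N = good_dem (verts t) (edges t) (root t)"
  proof -
    have "f a = f (root c) \<longleftrightarrow> a = root c" if "(a, b) \<in> edges c" for a b
      using inj_onD[OF ft(1)] root_in_verts[of c] that edges_verts[of c] by blast
    then have "{e \<in> edges t. fst e = root t} = map_prod f f ` {e \<in> edges c. fst e = root c}"
      by (auto simp: ft(3,4))
    then show ?thesis
      by (simp add: good_dem_def N_def ft image_Un image_image split_beta)
  qed
  then show ?thesis using s by (auto simp: good_def)
qed

lemma floating_by_check:
  assumes "floating_check c p" and t: "labs c = [0..<length (labs t)]" "wf_rt t" "map_rt ((!) (labs t)) c = t"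
  shows "floating (root t) (kids t)"
proof -
  define f where "f = (!) (labs t)"
  note ft = nth_labs[OF t, folded f_def]
  have kt: "kids t = map (map_rt f) (kids c)" using t(3) by (cases c; cases t) (auto simp: f_def)
  have nt: "Node (root t) (kids t) = t" "Node (root c) (kids c) = c" by simp_all
  define W where "W = set (concat (map labs (kids c)))"
  define D where "D = set (concat (map elist (kids c)))"
  define N where "N = set (floating_dem (kids c))"
  have "places (edges c) W D N ((!) p)"
    using assms(1) unfolding W_def D_def N_def floating_check_def by (rule places_check)
  moreover have WV: "W \<subseteq> verts c" by (cases c) (auto simp: W_def)
  moreover have DW: "D \<subseteq> W \<times> W" using edges_verts by (fastforce simp: D_def W_def)
  moreover have "v \<in> W" if "(k, u, v) \<in> N" for k u v
    using that by (force simp: N_def W_def floating_dem_def)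
  ultimately obtain s where s: "places (edges t) (f ` W) (map_prod f f ` D) (map_prod id (map_prod f f) ` N) s"
    using places_map[OF _ ft(1) edges_verts WV DW] ft by metis
  have "f ` W = set (concat (map labs (kids t)))"
    by (auto simp: W_def kt labs_map)
  moreover have "map_prod f f ` D = set (concat (map elist (kids t)))"
    by (auto simp: D_def kt elist_map)
  moreover have "map_prod id (map_prod f f) ` N = set (floating_dem (kids t))"
    by (simp add: N_def kt floating_dem_def image_Un image_image image_UN labs_map root_map)
  ultimately show ?thesis using s nt(1) by (auto simp: floating_def)
qed

lemma hinged_by_check:
  assumes "hinged_check c g p" and t: "labs c = [0..<length (labs t)]" "wf_rt t" "map_rt ((!) (labs t)) c = t"
    and g: "g < length (labs t)"
  shows "hinged (verts t) (edges t) (root t) (labs t ! g)"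
proof -
  define f where "f = (!) (labs t)"
  note ft = nth_labs[OF t, folded f_def]
  have fi: "f a = f b \<longleftrightarrow> a = b" if "a \<in> verts c" "b \<in> verts c" for a b
    using inj_onD[OF ft(1)] that by blast
  have gc: "g \<in> verts c" using g t(1) by simp
  define D where "D = {e \<in> edges c. fst e \<noteq> g \<and> snd e \<noteq> g}"
  have "places (edges c) (verts c) D (hinge_dem (verts c) (edges c) (root c) g) ((!) p)"
    using places_check[OF assms(1)[unfolded hinged_check_def]]
    by (simp add: D_def hinge_dem_def Un_ac insert_commute)
  moreover have DW: "D \<subseteq> verts c \<times> verts c" using edges_verts[of c] by (auto simp: D_def)
  moreover have "v \<in> verts c" if "(k, u, v) \<in> hinge_dem (verts c) (edges c) (root c) g" for k u v
    using that edges_verts[of c] gc by (auto simp: hinge_dem_def)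
  ultimately obtain s where s: "places (edges t) (verts t) (map_prod f f ` D)
      (map_prod id (map_prod f f) ` hinge_dem (verts c) (edges c) (root c) g) s"
    using places_map[OF _ ft(1) edges_verts order_refl DW] ft by metis
  have ec: "f a = f g \<longleftrightarrow> a = g" "f b = f g \<longleftrightarrow> b = g" "f a = f (root c) \<longleftrightarrow> a = root c"
    if "(a, b) \<in> edges c" for a b
    using that edges_verts[of c] fi gc root_in_verts[of c] by blast+
  have "map_prod f f ` D = {e \<in> edges t. fst e \<noteq> f g \<and> snd e \<noteq> f g}"
    by (auto simp: D_def ft(3) ec)
  moreover have "map_prod id (map_prod f f) ` hinge_dem (verts c) (edges c) (root c) g
      = hinge_dem (verts t) (edges t) (root t) (f g)"
  proof -
    have "{v \<in> verts t. v \<noteq> f g} = f ` {v \<in> verts c. v \<noteq> g}" using fi gc by (auto simp: ft(2))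
    moreover have "{e \<in> edges t. fst e = root t \<and> snd e \<noteq> f g}
        = map_prod f f ` {e \<in> edges c. fst e = root c \<and> snd e \<noteq> g}"
      by (auto simp: ft(3,4) ec)
    moreover have "{e \<in> edges t. fst e = f g} = map_prod f f ` {e \<in> edges c. fst e = g}"
      by (auto simp: ft(3) ec)
    ultimately show ?thesis
      by (simp add: hinge_dem_def ft(4) image_Un image_image split_beta)
  qed
  ultimately show ?thesis using s by (auto simp: hinged_def f_def)
qed

section \<open>Stars, bad trees and trees without twin leaves\<close>

definition leaf :: "'a rt \<Rightarrow> bool" where "leaf t \<longleftrightarrow> kids t = []"

text \<open>The root is either the centre of the star or one of its leaves, in which case
  \<open>c\<close> is the centre.\<close>

definition star :: "'a rt \<Rightarrow> bool" where
  "star t \<longleftrightarrow> (\<forall>s\<in>set (kids t). leaf s) \<or> (\<exists>c. kids t = [c] \<and> (\<forall>s\<in>set (kids c). leaf s))"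

text \<open>The path on five vertices rooted at its middle.\<close>

definition bad :: "'a rt \<Rightarrow> bool" where
  "bad t \<longleftrightarrow> (\<exists>x a b c d. t = Node x [Node a [Node b []], Node c [Node d []]])"

definition short :: "'a rt \<Rightarrow> bool" where
  "short t \<longleftrightarrow> (\<exists>a. t = Node a []) \<or> (\<exists>a b. t = Node a [Node b []])
     \<or> (\<exists>a b c. t = Node a [Node b [Node c []]])"

text \<open>Leaves are childless vertices. A root of degree one may still share its neighbour with a
  leaf: the root is never pruned.\<close>

fun twinfree :: "'a rt \<Rightarrow> bool" where
  "twinfree (Node x ts) \<longleftrightarrow> length (filter leaf ts) \<le> 1 \<and> (\<forall>t\<in>set ts. twinfree t)"

text \<open>In both tables the \<open>i\<close>-th entry of the list is the image of the vertex \<open>i\<close>; the placements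
  were found by computer search.\<close>

definition small_trees :: "(nat rt \<times> nat list) list" where
  "small_trees = [
    (Node 0 [Node 1 [Node 2 [Node 3 []]]], [1, 3, 0, 2]),
    (Node 0 [Node 1 [], Node 2 [Node 3 []]], [1, 2, 3, 0]),
    (Node 0 [Node 1 [], Node 2 [Node 3 [Node 4 []]]], [1, 2, 4, 0, 3]),
    (Node 0 [Node 1 [Node 2 []], Node 3 []], [3, 2, 0, 1]),
    (Node 0 [Node 1 [Node 2 []], Node 3 [Node 4 [Node 5 []]]], [3, 2, 0, 5, 1, 4]),
    (Node 0 [Node 1 [Node 2 [Node 3 []]], Node 4 []], [4, 3, 0, 2, 1]),
    (Node 0 [Node 1 [Node 2 [Node 3 []]], Node 4 [Node 5 []]], [1, 3, 4, 2, 5, 0]),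
    (Node 0 [Node 1 [Node 2 [Node 3 []]], Node 4 [Node 5 [Node 6 []]]], [1, 3, 4, 2, 6, 0, 5]),
    (Node 0 [Node 1 [], Node 2 [Node 3 []], Node 4 [Node 5 []]], [1, 2, 3, 4, 5, 0]),
    (Node 0 [Node 1 [Node 2 []], Node 3 [], Node 4 [Node 5 []]], [3, 2, 0, 4, 5, 1]),
    (Node 0 [Node 1 [Node 2 []], Node 3 [Node 4 []], Node 5 []], [5, 2, 0, 4, 1, 3]),
    (Node 0 [Node 1 [Node 2 []], Node 3 [Node 4 []], Node 5 [Node 6 []]], [1, 3, 5, 4, 0, 6, 2]),
    (Node 0 [Node 1 [Node 2 []], Node 3 [Node 4 []], Node 5 [Node 6 []], Node 7 [Node 8 []]], [1, 3, 5, 4, 0, 6, 7, 8, 2]),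
    (Node 0 [Node 1 [Node 2 [Node 3 [Node 4 []]]]], [1, 3, 0, 4, 2]),
    (Node 0 [Node 1 [Node 2 [Node 3 [Node 4 []]]], Node 5 []], [5, 2, 4, 0, 3, 1]),
    (Node 0 [Node 1 [Node 2 [Node 3 [Node 4 []]]], Node 5 [Node 6 []]], [1, 3, 5, 4, 0, 6, 2]),
    (Node 0 [Node 1 [Node 2 [], Node 3 [Node 4 []]]], [1, 4, 0, 2, 3]),
    (Node 0 [Node 1 [Node 2 [], Node 3 [Node 4 [Node 5 []]]]], [1, 4, 0, 2, 5, 3]),
    (Node 0 [Node 1 [Node 2 [Node 3 []], Node 4 []]], [1, 3, 4, 2, 0]),
    (Node 0 [Node 1 [Node 2 [Node 3 []], Node 4 [Node 5 []]]], [1, 3, 0, 4, 5, 2]),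
    (Node 0 [Node 1 [Node 2 [Node 3 []], Node 4 [Node 5 [Node 6 []]]]], [1, 3, 0, 4, 6, 2, 5]),
    (Node 0 [Node 1 [Node 2 [Node 3 [Node 4 []]], Node 5 []]], [1, 3, 5, 4, 2, 0]),
    (Node 0 [Node 1 [Node 2 [Node 3 [Node 4 []]], Node 5 [Node 6 []]]], [1, 3, 0, 4, 5, 6, 2]),
    (Node 0 [Node 1 [Node 2 [Node 3 [Node 4 []]], Node 5 [Node 6 [Node 7 []]]]], [1, 3, 0, 4, 5, 7, 2, 6]),
    (Node 0 [Node 1 [Node 2 [], Node 3 [Node 4 []]], Node 5 []], [5, 2, 3, 4, 0, 1]),
    (Node 0 [Node 1 [Node 2 [], Node 3 [Node 4 [Node 5 []]]], Node 6 []], [6, 2, 3, 5, 0, 4, 1]),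
    (Node 0 [Node 1 [Node 2 [Node 3 []], Node 4 []], Node 5 []], [5, 3, 4, 2, 0, 1]),
    (Node 0 [Node 1 [Node 2 [Node 3 []], Node 4 [Node 5 []]], Node 6 []], [6, 2, 0, 4, 5, 3, 1]),
    (Node 0 [Node 1 [Node 2 [Node 3 []], Node 4 [Node 5 [Node 6 []]]], Node 7 []], [7, 2, 0, 4, 6, 3, 5, 1]),
    (Node 0 [Node 1 [Node 2 [Node 3 [Node 4 []]], Node 5 []], Node 6 []], [6, 2, 0, 5, 3, 4, 1]),
    (Node 0 [Node 1 [Node 2 [Node 3 [Node 4 []]], Node 5 [Node 6 []]], Node 7 []], [7, 2, 0, 4, 5, 6, 3, 1]),
    (Node 0 [Node 1 [Node 2 [Node 3 [Node 4 []]], Node 5 [Node 6 [Node 7 []]]], Node 8 []], [8, 2, 0, 4, 5, 7, 3, 6, 1]),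
    (Node 0 [Node 1 [Node 2 [Node 3 [Node 4 []], Node 5 [Node 6 []]]]], [1, 3, 0, 2, 6, 4, 5]),
    (Node 0 [Node 1 [Node 2 [Node 3 [Node 4 []], Node 5 [Node 6 []]], Node 7 []]], [1, 3, 0, 2, 6, 4, 7, 5]),
    (Node 0 [Node 1 [Node 2 [Node 3 [Node 4 []], Node 5 [Node 6 []]]], Node 7 []], [7, 2, 0, 4, 5, 6, 3, 1]),
    (Node 0 [Node 1 [Node 2 [Node 3 [Node 4 []], Node 5 [Node 6 []]], Node 7 []], Node 8 [Node 9 []]], [1, 3, 0, 2, 6, 4, 5, 8, 9, 7]),
    (Node 0 [Node 1 [Node 2 [], Node 3 []], Node 4 []], [4, 2, 3, 0, 1]),
    (Node 0 [Node 1 [Node 2 [], Node 3 []], Node 4 [], Node 5 []], [4, 2, 3, 0, 5, 1]),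
    (Node 0 [Node 1 [Node 2 []], Node 3 [], Node 4 []], [3, 2, 0, 4, 1]),
    (Node 0 [Node 1 [Node 2 [Node 3 [], Node 4 []]]], [1, 3, 0, 4, 2]),
    (Node 0 [Node 1 [Node 2 [Node 3 [], Node 4 []], Node 5 []]], [1, 3, 0, 2, 5, 4]),
    (Node 0 [Node 1 [Node 2 []], Node 3 [Node 4 []], Node 5 [], Node 6 []], [5, 2, 0, 4, 1, 6, 3]),
    (Node 0 [Node 1 [Node 2 [], Node 3 [], Node 4 []], Node 5 [Node 6 []]], [1, 5, 3, 4, 2, 6, 0]),
    (Node 0 [Node 1 [Node 2 [Node 3 [], Node 4 []]], Node 5 [Node 6 []]], [1, 3, 4, 0, 5, 6, 2])]"

definition floating_trees :: "(nat rt \<times> nat list) list" where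
  "floating_trees = [
    (Node 0 [Node 1 [], Node 2 []], [0, 2, 1]),
    (Node 0 [Node 1 [], Node 2 [Node 3 []]], [0, 2, 3, 1]),
    (Node 0 [Node 1 [], Node 2 [Node 3 [Node 4 []]]], [0, 2, 4, 1, 3]),
    (Node 0 [Node 1 [Node 2 []], Node 3 []], [0, 2, 3, 1]),
    (Node 0 [Node 1 [Node 2 []], Node 3 [Node 4 []]], [0, 2, 3, 4, 1]),
    (Node 0 [Node 1 [Node 2 []], Node 3 [Node 4 [Node 5 []]]], [0, 2, 3, 5, 1, 4]),
    (Node 0 [Node 1 [Node 2 [Node 3 []]], Node 4 []], [0, 3, 4, 2, 1]),
    (Node 0 [Node 1 [Node 2 [Node 3 []]], Node 4 [Node 5 []]], [0, 3, 1, 4, 5, 2]),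
    (Node 0 [Node 1 [Node 2 [Node 3 []]], Node 4 [Node 5 [Node 6 []]]], [0, 3, 1, 4, 6, 2, 5]),
    (Node 0 [Node 1 [Node 2 [Node 3 []], Node 4 [Node 5 []]]], [0, 3, 4, 2, 5, 1])]"

lemma small_trees: "list_all (\<lambda>(c, p). good_check c p \<and> labs c = [0..<length (labs c)]) small_trees"
  by code_simp

lemma floating_trees:
  "list_all (\<lambda>(c, p). floating_check c p \<and> labs c = [0..<length (labs c)]) floating_trees"
  by code_simp

text \<open>Unfolded, this is a disjunction of equations of shapes, which the simplifier decides for
  a concrete shape with variables as labels.\<close>

definition listed :: "(nat rt \<times> nat list) list \<Rightarrow> 'a rt \<Rightarrow> bool" where
  "listed cs t \<longleftrightarrow> list_ex (\<lambda>(c, p). map_rt ((!) (labs t)) c = t) cs"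

lemma length_labs_map: "map_rt f c = t \<Longrightarrow> length (labs c) = length (labs t)"
  using labs_map[of f c] by (metis length_map)

lemma good_listed:
  assumes "listed small_trees t" "wf_rt t" shows "good_rt t"
proof -
  obtain c p where c: "(c, p) \<in> set small_trees" "map_rt ((!) (labs t)) c = t"
    using assms(1) by (auto simp: listed_def list_ex_iff)
  then have "good_check c p" "labs c = [0..<length (labs c)]"
    using small_trees by (auto simp: list_all_iff)
  then show ?thesis using good_by_check[of c p t] c(2) assms(2) length_labs_map[OF c(2)] by simp
qed

lemma floating_listed:
  assumes "listed floating_trees (Node v ts)" "wf_rt (Node v ts)" shows "floating v ts"
proof -
  let ?t = "Node v ts"
  obtain c p where c: "(c, p) \<in> set floating_trees" "map_rt ((!) (labs ?t)) c = ?t"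
    using assms(1) by (auto simp: listed_def list_ex_iff simp del: labs.simps)
  then have "floating_check c p" "labs c = [0..<length (labs c)]"
    using floating_trees by (auto simp: list_all_iff)
  then show ?thesis
    using floating_by_check[of c p ?t] c(2) assms(2) length_labs_map[OF c(2)] by simp
qed

lemmas listed_simps = listed_def small_trees_def floating_trees_def

text \<open>Three shapes for each branch, in either order, give the first nine entries of
  \<open>floating_trees\<close>.\<close>

lemma floating_pair:
  assumes "short a" "short b" "wf_rt (Node v [a, b])"
  shows "floating v [a, b]"
  using assms by (elim short_def[THEN iffD1, elim_format] disjE exE)
    (rule floating_listed; simp add: listed_simps)+

text \<open>The exceptional tree is harmless as a branch: its root may move by 2, to an end of the
  path, where a good placement would allow only 1.\<close>

lemma floating_bad:
  assumes "bad t" "wf_rt (Node v [t])"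
  shows "floating v [t]"
  using assms by (elim bad_def[THEN iffD1, elim_format] exE) (rule floating_listed; simp add: listed_simps)

lemma wf_rt_kid:
  assumes "wf_rt (Node x ts)" "s \<in> set ts" shows "wf_rt s" "x \<notin> verts s"
proof -
  show "x \<notin> verts s" using assms by auto
  show "wf_rt s" using assms by (induction ts) auto
qed

lemma edges_irrefl: "wf_rt t \<Longrightarrow> (u, u) \<notin> edges t"
proof (induction t rule: labs.induct)
  case (1 x ts)
  have "(u, u) \<notin> edges s \<and> x \<noteq> root s" if "s \<in> set ts" for s
    using 1 that wf_rt_kid[OF 1(2) that] root_in_verts[of s] by metis
  then show ?case by auto
qed

lemma hinged_branch:
  assumes h: "hinged (verts (Node x (Node y us # rest))) (edges (Node x (Node y us # rest))) x y"
    and g: "good_rt z" and w: "wf_rt (Node x (Node y (z # us) # rest))"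
  shows "good_rt (Node x (Node y (z # us) # rest))"
proof -
  let ?c = "Node x (Node y us # rest)" and ?t = "Node x (Node y (z # us) # rest)"
  have wc: "wf_rt ?c" "wf_rt z" using w by auto
  have "good (verts ?c \<union> verts z) (edges ?t) x"
  proof (rule hinged_attach[OF h g edges_verts sym_edges edges_verts sym_edges _ _ root_in_verts])
    show "x \<in> verts ?c" "y \<in> verts ?c" "x \<noteq> y" using w by auto
    show "verts ?c \<inter> verts z = {}" using w by auto
    show "(u, u) \<notin> edges ?c" for u using edges_irrefl[OF wc(1)] .
    show "(u, u) \<notin> edges z" for u using edges_irrefl[OF wc(2)] .
    show "edges ?t = edges ?c \<union> edges z \<union> {(y, root z), (root z, y)}" by auto
  qed
  moreover have "verts ?c \<union> verts z = verts ?t" by auto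
  ultimately show ?thesis by simp
qed

text \<open>These four trees are the stars and the bad tree that can remain in
  \<open>good_hanging\<close> when a branch is cut off below \<open>y\<close>.\<close>

lemma hinged_small:
  assumes "wf_rt t"
  shows "t = Node x [Node y []] \<Longrightarrow> hinged (verts t) (edges t) x y"
    "t = Node x [Node y [], Node w []] \<Longrightarrow> hinged (verts t) (edges t) x y"
    "t = Node x [Node y [Node l []]] \<Longrightarrow> hinged (verts t) (edges t) x y"
    "t = Node x [Node y [Node l []], Node w [Node k []]] \<Longrightarrow> hinged (verts t) (edges t) x y"
proof -
  have c: "hinged_check (Node 0 [Node 1 []]) 1 [1, 0]"
    "hinged_check (Node 0 [Node 1 [], Node 2 []]) 1 [2, 0, 1]"
    "hinged_check (Node 0 [Node 1 [Node 2 []]]) 1 [1, 2, 0]"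
    "hinged_check (Node 0 [Node 1 [Node 2 []], Node 3 [Node 4 []]]) 1 [1, 2, 3, 4, 0]"
    by code_simp+
  note h = c[THEN hinged_by_check, of t]
  show "t = Node x [Node y []] \<Longrightarrow> hinged (verts t) (edges t) x y"
    using h(1) assms by (simp add: upt_rec)
  show "t = Node x [Node y [], Node w []] \<Longrightarrow> hinged (verts t) (edges t) x y"
    using h(2) assms by (simp add: upt_rec)
  show "t = Node x [Node y [Node l []]] \<Longrightarrow> hinged (verts t) (edges t) x y"
    using h(3) assms by (simp add: upt_rec)
  show "t = Node x [Node y [Node l []], Node w [Node k []]] \<Longrightarrow> hinged (verts t) (edges t) x y"
    using h(4) assms by (simp add: upt_rec)
qed

lemma star_twinfree:
  assumes "star t" "twinfree t" shows "short t"
proof -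
  have leaves: "ts = [] \<or> (\<exists>a. ts = [Node a []])"
    if "\<forall>s\<in>set ts. leaf s" "length (filter leaf ts) \<le> 1" for ts :: "'a rt list"
  proof -
    have "filter leaf ts = ts" using that(1) by simp
    then have "length ts \<le> 1" using that(2) by simp
    moreover have "s = Node (root s) []" if "leaf s" for s :: "'a rt" using that by (cases s) (simp add: leaf_def)
    ultimately show ?thesis using that(1) by (cases ts) force+
  qed
  obtain x ts where t: "t = Node x ts" by (cases t)
  consider "\<forall>s\<in>set ts. leaf s" | y us where "ts = [Node y us]" "\<forall>s\<in>set us. leaf s"
    using assms(1) unfolding star_def t by (metis rt.collapse rt.sel(2))
  then show ?thesis
  proof cases
    case 1
    then show ?thesis using leaves[of ts] assms(2) by (auto simp: t short_def)
  next
    case 2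
    then show ?thesis using leaves[of us] assms(2) by (auto simp: t short_def)
  qed
qed

text \<open>Vertices and edges depend only on the set of kids, whereas distinctness and size depend
  on their multiset; reorderings are therefore stated through \<open>mset\<close>.\<close>

lemma good_cong:
  "set ts = set us \<Longrightarrow> good_rt (Node x ts) \<Longrightarrow> good_rt (Node x us)"
  by simp

lemma good_cong_kid:
  "set ts = set us \<Longrightarrow> good_rt (Node x (Node y ts # rest)) \<Longrightarrow> good_rt (Node x (Node y us # rest))"
  by simp

lemma mset_labs: "mset (labs (Node x ts)) = {#x#} + (\<Sum>s\<in>#mset ts. mset (labs s))"
  by (induction ts) simp_all

lemma wf_rt_cong:
  assumes "mset (labs t) = mset (labs s)" shows "wf_rt t \<longleftrightarrow> wf_rt s"
  using assms by (metis mset_eq_imp_distinct_iff)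

lemma wf_rt_perm: "mset ts = mset us \<Longrightarrow> wf_rt (Node x ts) \<longleftrightarrow> wf_rt (Node x us)"
  by (rule wf_rt_cong) (simp only: mset_labs)

lemma wf_rt_perm_kid:
  "mset ts = mset us \<Longrightarrow> wf_rt (Node x (Node y ts # rest)) \<longleftrightarrow> wf_rt (Node x (Node y us # rest))"
  by (rule wf_rt_cong) (simp add: mset_labs del: labs.simps)

section \<open>The induction\<close>

definition settled :: "'a rt \<Rightarrow> bool" where
  "settled t \<longleftrightarrow> (wf_rt t \<longrightarrow> \<not> star t \<longrightarrow> \<not> bad t \<longrightarrow> good_rt t)"

text \<open>The branch has a good placement unless it is bad, and then \<open>floating_bad\<close>
  applies.\<close>

lemma floating_nonstar:
  assumes "settled t" "\<not> star t" "wf_rt (Node v [t])"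
  shows "floating v [t]"
  using assms floating_single[of t v] floating_bad[of t v] by (auto simp: settled_def)

text \<open>The induction hypothesis as a predicate, which lets the cases be separate
  lemmas.\<close>

definition below :: "'a rt \<Rightarrow> bool" where
  "below t \<longleftrightarrow> (\<forall>s::'a rt. length (labs s) < length (labs t) \<longrightarrow> settled s)"

lemma labs_nonempty [simp]: "labs t \<noteq> []"
  by (cases t) simp

lemma length_mset: "length (labs (Node x ts)) = Suc (\<Sum>s\<in>#mset ts. length (labs s))"
  by (induction ts) simp_all

text \<open>The induction step at \<open>x\<close>. What remains in each application is to choose
  \<open>ds\<close> so that the rest satisfies the last two hypotheses.\<close>

lemma remove_root:
  assumes b: "below (Node x ts)" and f: "floating x ds" and w: "wf_rt (Node x ts)"
    and m: "mset ts = mset (ds @ us)" "ds \<noteq> []" and n: "\<not> star (Node x us)" "\<not> bad (Node x us)"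
  shows "good_rt (Node x ts)"
proof (rule good_cong)
  show "set (ds @ us) = set ts" using m(1) by (metis mset_eq_setD)
  have "length (labs (Node x us)) < length (labs (Node x ts))"
    using m(2) by (cases ds) (simp_all add: length_mset m(1) del: labs.simps)
  then have s: "settled (Node x us)" using b by (simp add: below_def)
  have w': "wf_rt (Node x (ds @ us))" using w wf_rt_perm[OF m(1)] by blast
  then have "wf_rt (Node x us)" by auto
  then show "good_rt (Node x (ds @ us))" using floating_root[OF f _ w'] s n by (simp add: settled_def)
qed

lemma remove_kid:
  assumes b: "below (Node x (Node y ts # rest))" and f: "floating y ds"
    and w: "wf_rt (Node x (Node y ts # rest))" and m: "mset ts = mset (ds @ us)" "ds \<noteq> []"
    and n: "\<not> star (Node x (Node y us # rest))" "\<not> bad (Node x (Node y us # rest))"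
  shows "good_rt (Node x (Node y ts # rest))"
proof (rule good_cong_kid)
  show "set (ds @ us) = set ts" using m(1) by (metis mset_eq_setD)
  have "length (labs (Node y us)) < length (labs (Node y ts))"
    using m(2) by (cases ds) (simp_all add: length_mset m(1) del: labs.simps)
  then have s: "settled (Node x (Node y us # rest))" using b by (simp add: below_def)
  have w': "wf_rt (Node x (Node y (ds @ us) # rest))" using w wf_rt_perm_kid[OF m(1)] by blast
  then have "wf_rt (Node x (Node y us # rest))" by auto
  then show "good_rt (Node x (Node y (ds @ us) # rest))"
    using floating_child[OF f _ w'] s n by (simp add: settled_def)
qed

lemma wf_rt_kids:
  assumes "wf_rt (Node x ts)" "mset ts = mset (ds @ us)" shows "wf_rt (Node x ds)" "wf_rt (Node x us)"
  using assms(1) wf_rt_perm[OF assms(2)] by auto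

lemma remove_pair_root:
  assumes "below (Node x ts)" "wf_rt (Node x ts)" "mset ts = mset ([a, b] @ us)" "short a" "short b"
    "\<not> star (Node x us)" "\<not> bad (Node x us)"
  shows "good_rt (Node x ts)"
  using remove_root[OF assms(1) _ assms(2,3) _ assms(6,7)] floating_pair[OF assms(4,5)]
    wf_rt_kids(1)[OF assms(2,3)] by blast

lemma remove_pair_kid:
  assumes "below (Node x (Node y ts # rest))" "wf_rt (Node x (Node y ts # rest))"
    "mset ts = mset ([a, b] @ us)" "short a" "short b"
    "\<not> star (Node x (Node y us # rest))" "\<not> bad (Node x (Node y us # rest))"
  shows "good_rt (Node x (Node y ts # rest))"
proof -
  have "wf_rt (Node y ts)" using assms(2) by auto
  then show ?thesis
    using remove_kid[OF assms(1) _ assms(2,3) _ assms(6,7)] floating_pair[OF assms(4,5)]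
      wf_rt_kids(1)[OF _ assms(3)] by blast
qed

section \<open>Trees without twin leaves\<close>

lemma shortE:
  assumes "short t"
  obtains a where "t = Node a []" | a b where "t = Node a [Node b []]"
    | a b c where "t = Node a [Node b [Node c []]]"
  using assms by (auto simp: short_def)

lemma leaf_eq: "leaf t \<Longrightarrow> t = Node (root t) []"
  by (cases t) (simp add: leaf_def)

text \<open>Up to two branches are tabulated. With more, two branches are removed, chosen so that
  what stays is neither a star nor bad; the few trees without such a choice are again in the
  table.\<close>

lemma good_all_short:
  assumes b: "below (Node x ts)" and w: "wf_rt (Node x ts)" and sh: "\<forall>t\<in>set ts. short t"
    and l: "length (filter leaf ts) \<le> 1" and n: "\<not> star (Node x ts)" "\<not> bad (Node x ts)"
  shows "good_rt (Node x ts)"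
proof -
  consider "ts = []" | A where "ts = [A]" | A B where "ts = [A, B]" | A B C where "ts = [A, B, C]"
    | A B C D r where "ts = A # B # C # D # r"
    by (metis list.exhaust)
  then show ?thesis
  proof cases
    case 1
    then show ?thesis using n by (simp add: star_def)
  next
    case 2
    have "short A" using sh 2 by simp
    then have "listed small_trees (Node x ts)"
      by (elim shortE) (use n in \<open>simp_all add: 2 star_def leaf_def listed_simps\<close>)
    then show ?thesis using w by (rule good_listed)
  next
    case 3
    have "short A" "short B" using sh 3 by simp_all
    then have "listed small_trees (Node x ts)"
      by (elim shortE) (use n l in \<open>simp_all add: 3 star_def bad_def leaf_def listed_simps\<close>)
    then show ?thesis using w by (rule good_listed)
  next
    case 4
    \<comment> \<open>Such a branch alone below \<open>x\<close> gives the path on four vertices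
      rooted at an end, so it is kept and the other two are removed.\<close>
    define P where "P t \<longleftrightarrow> (\<exists>a b c. t = Node a [Node b [Node c []]])" for t :: "'a rt"
    have P: "\<not> star (Node x [t])" "\<not> bad (Node x [t])" if "P t" for t
      using that by (auto simp: P_def star_def bad_def leaf_def)
    have s: "short A" "short B" "short C" using sh 4 by auto
    consider "P A" | "P B" | "P C" | "\<not> P A" "\<not> P B" "\<not> P C" by blast
    then show ?thesis
    proof cases
      case 1
      then show ?thesis using remove_pair_root[OF b w _ s(2,3) P] by (simp add: 4)
    next
      case 2
      then show ?thesis using remove_pair_root[OF b w _ s(1,3) P] by (simp add: 4)
    next
      case 3
      then show ?thesis using remove_pair_root[OF b w _ s(1,2) P] by (simp add: 4)
    next
      case other: 4
      from s have "listed small_trees (Node x ts)"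
        by (elim shortE) (use n l other in \<open>simp_all add: 4 star_def P_def leaf_def listed_simps\<close>)
      then show ?thesis using w by (rule good_listed)
    qed
  next
    case 5
    have s: "short A" "short B" "short C" "short D" using sh 5 by auto
    define P where "P t \<longleftrightarrow> (\<exists>a b. t = Node a [Node b []])" for t :: "'a rt"
    have bad2: "bad (Node x [t, u]) \<longleftrightarrow> P t \<and> P u" for t u by (auto simp: bad_def P_def)
    have star2: "\<not> star (Node x [t, u])" if "P u" for t u
      using that by (auto simp: P_def star_def leaf_def)
    \<comment> \<open>Removing \<open>A\<close> and \<open>B\<close> fails only if exactly two legs
      of two vertices stay. Then a leg of another shape is kept in place of \<open>C\<close>, or all
      four legs have two vertices and the tree is tabulated.\<close>
    consider "\<not> bad (Node x (C # D # r))" | "bad (Node x (C # D # r))" "P A" "P B"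
      | "bad (Node x (C # D # r))" "\<not> P A" | "bad (Node x (C # D # r))" "\<not> P B" by blast
    then show ?thesis
    proof cases
      case 1
      have "\<not> star (Node x (C # D # r))" using l by (auto simp: 5 star_def split: if_splits)
      then show ?thesis using remove_pair_root[OF b w _ s(1,2) _ 1] by (simp add: 5)
    next
      case 2
      then have "P A" "P B" "P C" "P D" "r = []" by (auto simp: bad_def P_def)
      then have "listed small_trees (Node x ts)"
        unfolding P_def by (elim exE) (simp add: 5 listed_simps)
      then show ?thesis using w by (rule good_listed)
    next
      case 3
      then have r: "r = []" and D: "P C" "P D" by (auto simp: bad_def P_def)
      show ?thesis
        using remove_pair_root[OF b w _ s(2,3) star2[OF D(2)], of A] 3(2) by (simp add: 5 r bad2)
    next
      case 4
      then have r: "r = []" and D: "P C" "P D" by (auto simp: bad_def P_def)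
      show ?thesis
        using remove_pair_root[OF b w _ s(1,3) star2[OF D(2)], of B] 4(2) by (simp add: 5 r bad2)
    qed
  qed
qed

text \<open>Cutting off the branch at \<open>y\<close> would leave a star around \<open>x\<close>.
  The search for something to remove therefore goes one level down, to the branches at
  \<open>y\<close>.\<close>

lemma good_hanging:
  assumes b: "below (Node x (Node y us # rest))" and w: "wf_rt (Node x (Node y us # rest))"
    and rest: "rest = [] \<or> (\<exists>a. rest = [Node a []]) \<or> (\<exists>a c. rest = [Node a [Node c []]])"
    and n: "\<not> star (Node y us)" and tf: "twinfree (Node y us)"
  shows "good_rt (Node x (Node y us # rest))"
proof (cases "\<forall>t\<in>set us. short t")
  case True
  consider "us = []" | A where "us = [A]" | A B where "us = [A, B]" | A B C r where "us = A # B # C # r"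
    by (metis list.exhaust)
  then show ?thesis
  proof cases
    case 1
    then show ?thesis using n by (simp add: star_def)
  next
    case 2
    have "short A" using True 2 by simp
    with rest have "listed small_trees (Node x (Node y us # rest))"
      by (elim shortE disjE exE) (use n in \<open>simp_all add: 2 star_def leaf_def listed_simps\<close>)
    then show ?thesis using w by (rule good_listed)
  next
    case 3
    \<comment> \<open>If \<open>rest\<close> has a leg of two vertices, dropping both
      \<open>A\<close> and \<open>B\<close> leaves a path on four vertices; otherwise the tree is in
      the table.\<close>
    show ?thesis
    proof (cases "\<exists>a c. rest = [Node a [Node c []]]")
      case True': True
      then have "\<not> star (Node x (Node y [] # rest))" "\<not> bad (Node x (Node y [] # rest))"
        by (auto simp: star_def bad_def leaf_def)
      then show ?thesis using remove_pair_kid[OF b w, of A B "[]"] True by (simp add: 3)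
    next
      case False
      have "short A" "short B" "rest = [] \<or> (\<exists>a. rest = [Node a []])" using True rest False 3 by auto
      then have "listed small_trees (Node x (Node y us # rest))"
        by (elim shortE disjE exE) (use tf in \<open>simp_all add: 3 leaf_def listed_simps\<close>)
      then show ?thesis using w by (rule good_listed)
    qed
  next
    case 4
    \<comment> \<open>With a child of \<open>K\<close> the tree reaches depth three below
      \<open>x\<close>, deeper than any star or bad tree.\<close>
    have keep: "\<not> star (Node x (Node y (K # r) # rest))" "\<not> bad (Node x (Node y (K # r) # rest))"
      if "\<not> leaf K" for K
      using that rest by (auto simp: star_def bad_def leaf_def)
    have s: "short A" "short B" "short C" using True 4 by auto
    show ?thesis
    proof (cases "leaf C")
      case True
      then have "\<not> leaf A" using tf by (auto simp: 4 split: if_splits)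
      then show ?thesis using remove_pair_kid[OF b w _ s(2,3) keep] by (simp add: 4)
    next
      case False
      then show ?thesis using remove_pair_kid[OF b w _ s(1,2) keep] by (simp add: 4)
    qed
  qed
next
  case False
  then obtain z where z: "z \<in> set us" "\<not> short z" by blast
  then obtain u1 u2 where us: "us = u1 @ z # u2" by (meson split_list)
  define us' where "us' = u1 @ u2"
  have m: "mset us = mset ([z] @ us')" by (simp add: us us'_def)
  have nz: "\<not> star z" using star_twinfree z tf by auto
  have wy: "wf_rt (Node y us)" using w by auto
  have lz: "length (labs z) < length (labs (Node x (Node y us # rest)))"
    by (simp add: us)
  then have sz: "settled z" using b by (simp add: below_def)
  have wz: "wf_rt (Node y [z])" using wf_rt_kids(1)[OF wy m] .
  have f: "floating y [z]" using floating_nonstar[OF sz nz wz] .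
  show ?thesis
  proof (cases "star (Node x (Node y us' # rest)) \<or> bad (Node x (Node y us' # rest))")
    case False
    then show ?thesis using remove_kid[OF b f w m] by simp
  next
    case True
    have w': "wf_rt (Node x (Node y (z # us') # rest))"
      using w wf_rt_perm_kid[of us "z # us'" x y rest] m by (simp only: append_Cons append_Nil)
    have tf': "length (filter leaf us') \<le> 1" using tf by (auto simp: us us'_def split: if_splits)
    have us': "us' = [] \<or> (\<exists>l. us' = [Node l []])" if "\<forall>s\<in>set us'. leaf s"
    proof -
      have "filter leaf us' = us'" using that by simp
      then have "length us' \<le> 1" using tf' by simp
      then show ?thesis using that leaf_eq by (cases us') force+
    qed
    \<comment> \<open>\<open>us'\<close> has at most one leaf, which cuts the possible stars and bad
      trees down to the four of \<open>hinged_small\<close>.\<close>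
    have form: "us' = [] \<and> rest = [] \<or> us' = [] \<and> (\<exists>a. rest = [Node a []])
      \<or> (\<exists>l. us' = [Node l []]) \<and> rest = []
      \<or> (\<exists>l. us' = [Node l []]) \<and> (\<exists>a c. rest = [Node a [Node c []]])"
      using True rest us' by (auto simp: star_def bad_def leaf_def)
    have "good_rt (Node x (Node y (z # us') # rest))"
    \<comment> \<open>The hinge needs a good placement of \<open>z\<close> itself. If
      \<open>z\<close> is bad, everything has bounded size and each of the four remainders gives a
      table entry.\<close>
    proof (cases "bad z")
      case True
      from form True[unfolded bad_def] have "listed small_trees (Node x (Node y (z # us') # rest))"
        by (elim disjE conjE exE) (simp_all add: listed_simps)
      then show ?thesis using w' by (rule good_listed)
    next
      case False
      then have gz: "good_rt z" using sz nz wz by (simp add: settled_def)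
      have wc: "wf_rt (Node x (Node y us' # rest))" using w' by auto
      have "hinged (verts (Node x (Node y us' # rest))) (edges (Node x (Node y us' # rest))) x y"
        using form hinged_small[OF wc, of x y] by blast
      then show ?thesis using gz w' by (rule hinged_branch)
    qed
    then show ?thesis by (rule good_cong_kid[rotated]) (use m in \<open>metis mset_eq_setD append_Cons append_Nil\<close>)
  qed
qed

lemma good_twinfree:
  assumes b: "below t" and w: "wf_rt t" and n: "\<not> star t" "\<not> bad t" and tf: "twinfree t"
  shows "good_rt t"
proof (cases t)
  case (Node x ts)
  note b = b[unfolded Node] and w = w[unfolded Node] and n = n[unfolded Node] and tf = tf[unfolded Node]
  have "good_rt (Node x ts)"
  proof (cases "\<forall>t\<in>set ts. short t")
    case True
    show ?thesis by (rule good_all_short[OF b w True _ n]) (use tf in simp)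
  next
    case False
    then obtain g where g: "g \<in> set ts" "\<not> short g" by blast
    then obtain t1 t2 where ts: "ts = t1 @ g # t2" by (meson split_list)
    define rest where "rest = t1 @ t2"
    have m: "mset ts = mset ([g] @ rest)" by (simp add: ts rest_def)
    have tfg: "twinfree g" and tfr: "twinfree (Node x rest)" using tf by (auto simp: ts rest_def split: if_splits)
    have ng: "\<not> star g" using star_twinfree g tfg by auto
    have wg: "wf_rt (Node x [g])" using wf_rt_kids(1)[OF w m] .
    have "settled g" using b by (simp add: below_def ts)
    then have f: "floating x [g]" using ng wg by (intro floating_nonstar)
    \<comment> \<open>If cutting off \<open>g\<close> leaves the bad tree, its two legs are removed
      instead and \<open>g\<close> stays, which is neither a star nor bad below \<open>x\<close>. If
      it leaves a star, the work moves to the child \<open>g\<close>.\<close>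
    consider "\<not> star (Node x rest)" "\<not> bad (Node x rest)" | "bad (Node x rest)" | "star (Node x rest)"
      by blast
    then show ?thesis
    proof cases
      case 1
      then show ?thesis using remove_root[OF b f w m] by simp
    next
      case 2
      then obtain p q where r: "rest = [p, q]" "short p" "short q"
        by (auto simp: bad_def short_def)
      have "\<not> star (Node x [g])" "\<not> bad (Node x [g])"
        using ng by (auto simp: star_def bad_def leaf_def)
      then show ?thesis using remove_pair_root[OF b w _ r(2,3), of "[g]"] by (simp add: m r(1))
    next
      case 3
      then have "short (Node x rest)" using star_twinfree tfr by blast
      then have r: "rest = [] \<or> (\<exists>a. rest = [Node a []]) \<or> (\<exists>a c. rest = [Node a [Node c []]])"
        by (auto simp: short_def)
      obtain y us where gy: "g = Node y us" by (cases g)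
      have m': "mset ts = mset (Node y us # rest)" using m gy by simp
      have b': "below (Node x (Node y us # rest))"
        using b m' by (simp add: below_def length_mset del: labs.simps)
      have w': "wf_rt (Node x (Node y us # rest))" using w wf_rt_perm[OF m'] by blast
      have "good_rt (Node x (Node y us # rest))"
        using good_hanging[OF b' w' r] ng tfg unfolding gy by blast
      then show ?thesis by (rule good_cong[rotated]) (metis m' mset_eq_setD)
    qed
  qed
  then show ?thesis by (simp only: Node)
qed

section \<open>Pairs of leaves with a common neighbour\<close>

inductive prune :: "'a rt \<Rightarrow> 'a rt \<Rightarrow> bool" where
  here: "leaf a \<Longrightarrow> leaf b \<Longrightarrow> prune (Node v (us @ a # vs @ b # ws)) (Node v (us @ vs @ ws))"
| inside: "prune s s' \<Longrightarrow> prune (Node v (us @ s # vs)) (Node v (us @ s' # vs))"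

lemma ex_prune: "\<not> twinfree t \<Longrightarrow> \<exists>t'. prune t t'"
proof (induction t rule: twinfree.induct)
  case (1 x ts)
  show ?case
  proof (cases "\<forall>t\<in>set ts. twinfree t")
    case True
    \<comment> \<open>\<open>remdups_adj.cases\<close> serves as the split of a list into empty,
      singleton, and at least two entries.\<close>
    then obtain a b r where "filter leaf ts = a # b # r"
      using 1(2) by (cases "filter leaf ts" rule: remdups_adj.cases) auto
    then obtain us ts' where a: "ts = us @ a # ts'" "leaf a" "filter leaf ts' = b # r"
      using filter_eq_ConsD by metis
    then obtain vs ws where "ts' = vs @ b # ws" "leaf b" using filter_eq_ConsD by metis
    then show ?thesis using a prune.here[of a b x us vs ws] by auto
  next
    case False
    then obtain s where s: "s \<in> set ts" "\<not> twinfree s" by blast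
    then obtain s' where "prune s s'" using 1(1) by blast
    moreover obtain us vs where "ts = us @ s # vs" using s(1) by (meson split_list)
    ultimately show ?thesis using prune.inside[of s s' x us vs] by auto
  qed
qed

lemma prune_root: "prune t t' \<Longrightarrow> root t = root t'"
  by (induction rule: prune.induct) auto

text \<open>The summand \<open>{}\<close> is the edge set \<open>D\<close> of
  \<open>good_attach\<close>, so that the equation fits its hypothesis as it stands.\<close>

lemma prune_graph:
  assumes "prune t t'" "wf_rt t"
  shows "wf_rt t' \<and> (\<exists>v a b. v \<in> verts t' \<and> a \<noteq> b \<and> verts t' \<inter> {a, b} = {} \<and> verts t = verts t' \<union> {a, b}
     \<and> edges t = edges t' \<union> {} \<union> {v} \<times> {a, b} \<union> {a, b} \<times> {v})"
  using assms
proof (induction rule: prune.induct)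
  case (here a b v us vs ws)
  obtain p q where [simp]: "a = Node p []" "b = Node q []" using here(1,2) leaf_eq by blast
  have "wf_rt (Node v (us @ vs @ ws))" "p \<noteq> q" "verts (Node v (us @ vs @ ws)) \<inter> {p, q} = {}"
    using here(3) by auto
  moreover have "verts (Node v (us @ a # vs @ b # ws)) = verts (Node v (us @ vs @ ws)) \<union> {p, q}"
    by auto
  moreover have "edges (Node v (us @ a # vs @ b # ws))
      = edges (Node v (us @ vs @ ws)) \<union> {} \<union> {v} \<times> {p, q} \<union> {p, q} \<times> {v}"
    by auto
  moreover have "v \<in> verts (Node v (us @ vs @ ws))" by simp
  ultimately show ?case by blast
next
  case (inside s s' v us vs)
  have "wf_rt s" using inside(3) by auto
  then obtain u a b where u: "wf_rt s'" "u \<in> verts s'" "a \<noteq> b" "verts s' \<inter> {a, b} = {}"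
    "verts s = verts s' \<union> {a, b}" "edges s = edges s' \<union> {} \<union> {u} \<times> {a, b} \<union> {a, b} \<times> {u}"
    using inside(2) by blast
  have "wf_rt (Node v (us @ s' # vs))" using inside(3) u(1,5) by auto
  moreover have "u \<in> verts (Node v (us @ s' # vs))" using u(2) by simp
  moreover have "verts (Node v (us @ s' # vs)) \<inter> {a, b} = {}" using inside(3) u(4,5) by auto
  moreover have "verts (Node v (us @ s # vs)) = verts (Node v (us @ s' # vs)) \<union> {a, b}"
    using u(5) by auto
  moreover have "edges (Node v (us @ s # vs)) = edges (Node v (us @ s' # vs))
      \<union> {} \<union> {u} \<times> {a, b} \<union> {a, b} \<times> {u}"
    using u(6) prune_root[OF inside(1)] by auto
  ultimately show ?case using u(3) by blast
qed

lemma prune_length: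
  assumes "prune t t'" shows "length (labs t') < length (labs t)"
  using assms by (induction rule: prune.induct) auto

text \<open>Swapping two leaves at a common neighbour \<open>v\<close> works even if \<open>v\<close> is moved by four.\<close>

lemma good_prune:
  assumes "prune t t'" "wf_rt t" "good_rt t'"
  shows "good_rt t"
proof -
  obtain v a b where g: "v \<in> verts t'" "a \<noteq> b" "verts t' \<inter> {a, b} = {}" "verts t = verts t' \<union> {a, b}"
    "edges t = edges t' \<union> {} \<union> {v} \<times> {a, b} \<union> {a, b} \<times> {v}"
    using prune_graph[OF assms(1,2)] by blast
  define s where "s = id(a := b, b := a)"
  have s: "s a = b" "s b = a" using g(2) by (simp_all add: s_def)
  have e: "(v, a) \<in> edges t" "(v, b) \<in> edges t" "(a, v) \<in> edges t" "(b, v) \<in> edges t" using g(5) by auto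
  have ab: "near (edges t) 2 a b" "near (edges t) 2 b a"
    using near_trans[OF near_edge[OF e(3)] near_edge[OF e(2)], of 2]
      near_trans[OF near_edge[OF e(4)] near_edge[OF e(1)], of 2] by simp_all
  have "good (verts t' \<union> {a, b}) (edges t) (root t')"
  proof (rule good_attach[OF assms(3) edges_verts sym_edges root_in_verts g(1,3) _ _ g(5), where t = s and m = 1])
    show "bij_betw s {a, b} {a, b}" using g(2) s by (auto simp: bij_betw_def)
    show "s u \<noteq> u" "near (edges t) 4 u (s u)" if "u \<in> {a, b}" for u
      using that s g(2) near_mono[OF ab(1) order_refl, of 4] near_mono[OF ab(2) order_refl, of 4] by auto
    show "near (edges t) 1 v (s r)" if "r \<in> {a, b}" for r using that s e near_edge by fastforce
    show "near (edges t) 2 r (s r)" if "r \<in> {a, b}" for r using that s ab by auto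
  qed (auto simp: sym_def)
  then show ?thesis using g(4) prune_root[OF assms(1)] by simp
qed

section \<open>Trees that prune to a star or to the bad tree\<close>

lemma prune_cases:
  assumes "prune (Node v ts) t'"
  obtains a b us where "t' = Node v us" "mset ts = mset ([a, b] @ us)" "leaf a" "leaf b"
  | us s s' vs where "ts = us @ s # vs" "t' = Node v (us @ s' # vs)" "prune s s'"
  using assms
proof (cases rule: prune.cases)
  case (here a b us vs ws)
  then show ?thesis using that(1)[of "us @ vs @ ws" a b] by simp
next
  case (inside s s' us vs)
  then show ?thesis using that(2) by blast
qed

lemma prune_to_leaf:
  assumes "prune s s'" "leaf s'"
  obtains v a b where "s = Node v [Node a [], Node b []]"
proof -
  obtain v ts where s: "s = Node v ts" by (cases s)
  from assms(1)[unfolded s] show ?thesis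
  proof (cases rule: prune_cases)
    case (1 a b us)
    then have "mset ts = mset [a, b]" using assms(2) by (simp add: leaf_def)
    then have "size (mset ts) = 2" "set_mset (mset ts) = {a, b}" by simp_all
    then obtain p q where "ts = [p, q]" "{p, q} = {a, b}"
      by (auto simp: numeral_2_eq_2 length_Suc_conv)
    moreover from this have "leaf p" "leaf q" using 1(3,4) by (auto simp: doubleton_eq_iff)
    ultimately have "s = Node v [Node (root p) [], Node (root q) []]" using s leaf_eq by metis
    then show ?thesis by (rule that)
  next
    case (2 us s s' vs)
    then show ?thesis using assms(2) by (simp add: leaf_def)
  qed
qed

lemma all_leafE:
  assumes "\<forall>s\<in>set ts. leaf s"
  obtains xs where "ts = map (\<lambda>y. Node y []) xs"
proof
  show "ts = map (\<lambda>y. Node y []) (map root ts)"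
    unfolding map_map by (rule map_idI[symmetric]) (use assms leaf_eq in force)
qed

text \<open>Brings the kids into the order of a table entry or of a lemma. \<open>below\<close>
  carries over since it depends only on the number of vertices.\<close>

lemma good_permute:
  assumes m: "mset ts = mset us" and b: "below (Node x ts)" and w: "wf_rt (Node x ts)"
    and g: "below (Node x us) \<Longrightarrow> wf_rt (Node x us) \<Longrightarrow> good_rt (Node x us)"
  shows "good_rt (Node x ts)"
proof (rule good_cong)
  show "set us = set ts" using m by (metis mset_eq_setD)
  have "below (Node x us)" using b by (simp add: below_def length_mset m del: labs.simps)
  moreover have "wf_rt (Node x us)" using w wf_rt_perm[OF m] by blast
  ultimately show "good_rt (Node x us)" by (rule g)
qed

lemma good_permute_kid:
  assumes m: "mset ts = mset us" and b: "below (Node x (Node y ts # rest))"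
    and w: "wf_rt (Node x (Node y ts # rest))"
    and g: "below (Node x (Node y us # rest)) \<Longrightarrow> wf_rt (Node x (Node y us # rest)) \<Longrightarrow>
      good_rt (Node x (Node y us # rest))"
  shows "good_rt (Node x (Node y ts # rest))"
proof (rule good_cong_kid)
  show "set us = set ts" using m by (metis mset_eq_setD)
  have "below (Node x (Node y us # rest))" using b by (simp add: below_def length_mset m del: labs.simps)
  moreover have "wf_rt (Node x (Node y us # rest))" using w wf_rt_perm_kid[OF m] by blast
  ultimately show "good_rt (Node x (Node y us # rest))" by (rule g)
qed

lemma short_leaf [simp]: "short (Node y [])"
  by (simp add: short_def)

lemma leaf_Node [simp]: "leaf (Node y ts) \<longleftrightarrow> ts = []"
  by (simp add: leaf_def)

text \<open>If \<open>xs\<close> were empty, this would be a star centred at \<open>v\<close>. From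
  three leaves at \<open>x\<close> on, two can go and one still prevents a star.\<close>

lemma good_fork_root:
  assumes b: "below (Node x (Node v [Node p [], Node q []] # map (\<lambda>y. Node y []) xs))" (is "below (Node x (?s # _))")
    and w: "wf_rt (Node x (Node v [Node p [], Node q []] # map (\<lambda>y. Node y []) xs))"
    and n: "xs \<noteq> []"
  shows "good_rt (Node x (Node v [Node p [], Node q []] # map (\<lambda>y. Node y []) xs))"
proof -
  consider y where "xs = [y]" | y z where "xs = [y, z]" | y z k r where "xs = y # z # k # r"
    using n by (metis list.exhaust)
  then show ?thesis
  proof cases
    case 3
    have m: "mset (?s # map (\<lambda>y. Node y []) xs)
        = mset ([Node y [], Node z []] @ ?s # map (\<lambda>y. Node y []) (k # r))" by (simp add: 3)
    show ?thesis
      by (rule remove_pair_root[OF b w m]) (auto simp: star_def bad_def)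
  qed (rule good_listed[OF _ w], simp add: listed_simps)+
qed

text \<open>Taking away \<open>p\<close> and \<open>q\<close> would leave a star, so the pair is
  taken from the leaves at \<open>y\<close>, of which at least one must stay.\<close>

lemma good_two_leaves:
  assumes b: "below (Node x [Node y (map (\<lambda>y. Node y []) xs), Node p [], Node q []])"
    and w: "wf_rt (Node x [Node y (map (\<lambda>y. Node y []) xs), Node p [], Node q []])"
    and n: "xs \<noteq> []"
  shows "good_rt (Node x [Node y (map (\<lambda>y. Node y []) xs), Node p [], Node q []])"
proof -
  consider k where "xs = [k]" | k l where "xs = [k, l]" | k l m r where "xs = k # l # m # r"
    using n by (metis list.exhaust)
  then show ?thesis
  proof cases
    case 3
    have m: "mset (map (\<lambda>y. Node y []) xs)
        = mset ([Node k [], Node l []] @ map (\<lambda>y. Node y []) (m # r))" by (simp add: 3)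
    show ?thesis
      by (rule remove_pair_kid[OF b w m]) (auto simp: star_def bad_def)
  qed (rule good_listed[OF _ w], simp add: listed_simps)+
qed

lemma good_fork_kid:
  assumes b: "below (Node x [Node c (Node v [Node p [], Node q []] # map (\<lambda>y. Node y []) xs)])"
      (is "below (Node x [Node c (?s # _)])")
    and w: "wf_rt (Node x [Node c (Node v [Node p [], Node q []] # map (\<lambda>y. Node y []) xs)])"
  shows "good_rt (Node x [Node c (Node v [Node p [], Node q []] # map (\<lambda>y. Node y []) xs)])"
proof -
  consider "xs = []" | y where "xs = [y]" | y z r where "xs = y # z # r"
    by (metis list.exhaust)
  then show ?thesis
  proof cases
    case 3
    have m: "mset (?s # map (\<lambda>y. Node y []) xs)
        = mset ([Node y [], Node z []] @ ?s # map (\<lambda>y. Node y []) r)" by (simp add: 3)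
    show ?thesis
      by (rule remove_pair_kid[OF b w m]) (auto simp: star_def bad_def)
  qed (rule good_listed[OF _ w], simp add: listed_simps)+
qed

text \<open>Putting the two leaves back onto a star gives a star again or one of the three preceding
  families, according to where they are attached. There another pair can be removed, or the tree is
  small.\<close>

lemma good_prune_star:
  assumes b: "below t" and w: "wf_rt t" and n: "\<not> star t" and p: "prune t t'" and st: "star t'"
  shows "good_rt t"
proof (cases t)
  case t: (Node x ts)
  note b = b[unfolded t] and w = w[unfolded t] and n = n[unfolded t]
  from p[unfolded t] have "good_rt (Node x ts)"
  proof (cases rule: prune_cases)
    case (1 a b' us)
    have "set ts = set ([a, b'] @ us)" using 1(2) by (metis mset_eq_setD)
    then have "\<not> (\<forall>s\<in>set us. leaf s)" using n 1(3,4) by (auto simp: star_def)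
    then obtain c where c: "us = [c]" "\<forall>s\<in>set (kids c). leaf s" "\<not> leaf c"
      using st 1(1) by (auto simp: star_def)
    obtain y ls where y: "c = Node y ls" by (cases c)
    obtain xs where xs: "ls = map (\<lambda>y. Node y []) xs" using c(2) y by (auto elim: all_leafE)
    have ab: "a = Node (root a) []" "b' = Node (root b') []" using 1(3,4) leaf_eq by blast+
    have "mset ts = mset [Node y (map (\<lambda>y. Node y []) xs), Node (root a) [], Node (root b') []]"
      using 1(2) c(1) y xs ab by simp
    then show ?thesis
      by (rule good_permute[OF _ b w]) (rule good_two_leaves, use c(3) y xs in auto)
  next
    case (2 us s s' vs)
    consider "\<forall>s\<in>set (us @ s' # vs). leaf s" | "us = []" "vs = []" "\<forall>s\<in>set (kids s'). leaf s"
      using st 2(2) by (auto simp: star_def append_eq_Cons_conv)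
    then show ?thesis
    proof cases
      case 1
      then have "leaf s'" by simp
      then obtain v p q where s: "s = Node v [Node p [], Node q []]"
        using prune_to_leaf[OF 2(3)] by metis
      obtain xs where xs: "us @ vs = map (\<lambda>y. Node y []) xs" using 1 by (elim all_leafE[of "us @ vs", rotated]) auto
      have "xs \<noteq> []" using n xs by (auto simp: star_def 2(1) s)
      have "mset ts = mset (s # us @ vs)" by (simp add: 2(1))
      then have "mset ts = mset (Node v [Node p [], Node q []] # map (\<lambda>y. Node y []) xs)"
        by (simp only: s xs)
      then show ?thesis by (rule good_permute[OF _ b w]) (rule good_fork_root, use \<open>xs \<noteq> []\<close> in auto)
    next
      case s': 2
      obtain c ss where s: "s = Node c ss" by (cases s)
      have ts: "ts = [Node c ss]" using 2(1) s' s by simp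
      from 2(3)[unfolded s] show ?thesis
      proof (cases rule: prune_cases)
        case (1 a b us)
        have "set ss = set ([a, b] @ us)" using 1(2) by (metis mset_eq_setD)
        then have "star (Node x ts)" using 1 s'(3) by (auto simp: star_def ts)
        then show ?thesis using n by blast
      next
        case p: (2 us1 p p' vs1)
        then have "leaf p'" using s'(3) by simp
        then obtain v k l where p': "p = Node v [Node k [], Node l []]"
          using prune_to_leaf[OF p(3)] by metis
        obtain xs where xs: "us1 @ vs1 = map (\<lambda>y. Node y []) xs"
          using s'(3) p(2) by (elim all_leafE[of "us1 @ vs1", rotated]) auto
        have "mset ss = mset (p # us1 @ vs1)" by (simp add: p(1))
        then have "mset ss = mset (Node v [Node k [], Node l []] # map (\<lambda>y. Node y []) xs)"
          by (simp only: p' xs)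
        then show ?thesis
          unfolding ts by (rule good_permute_kid[OF _ b[unfolded ts] w[unfolded ts]]) (rule good_fork_kid)
      qed
    qed
  qed
  then show ?thesis by (simp only: t)
qed

text \<open>Two leaves put back onto the path of five vertices hang at its middle, at an inner
  vertex or at an end. Up to symmetry these are the last three entries of
  \<open>small_trees\<close>.\<close>

lemma good_prune_bad:
  assumes b: "below t" and w: "wf_rt t" and p: "prune t t'" and st: "bad t'"
  shows "good_rt t"
proof (cases t)
  case t: (Node x ts)
  note b = b[unfolded t] and w = w[unfolded t]
  obtain x' a c d e where t': "t' = Node x' [Node a [Node c []], Node d [Node e []]]"
    using st by (auto simp: bad_def)
  from p[unfolded t] have "good_rt (Node x ts)"
  proof (cases rule: prune_cases)
    case (1 l k us)
    have lk: "l = Node (root l) []" "k = Node (root k) []" using 1(3,4) leaf_eq by blast+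
    have "mset ts = mset [Node a [Node c []], Node d [Node e []], Node (root l) [], Node (root k) []]"
      using 1(1,2) t' lk by auto
    then show ?thesis
      by (rule good_permute[OF _ b w]) (rule good_listed, simp_all add: listed_simps)
  next
    case (2 us s s' vs)
    then have "us @ s' # vs = [Node a [Node c []], Node d [Node e []]]" using t' by simp
    then obtain f g f' g' where s': "s' = Node f [Node g []]" "us @ vs = [Node f' [Node g' []]]"
      by (auto simp: append_eq_Cons_conv)
    obtain ss where s: "s = Node f ss" using prune_root[OF 2(3)] s' by (cases s) auto
    have "mset ts = mset (s # us @ vs)" by (simp add: 2(1))
    then have m: "mset ts = mset [s, Node f' [Node g' []]]" by (simp only: s')
    from 2(3)[unfolded s] show ?thesis
    proof (cases rule: prune_cases)
      case (1 l k us)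
      have lk: "l = Node (root l) []" "k = Node (root k) []" using 1(3,4) leaf_eq by blast+
      have m': "mset ss = mset [Node (root l) [], Node (root k) [], Node g []]"
        using 1(1,2) s' lk by auto
      show ?thesis
      proof (rule good_permute[OF m[unfolded s] b w])
        assume "below (Node x [Node f ss, Node f' [Node g' []]])" "wf_rt (Node x [Node f ss, Node f' [Node g' []]])"
        then show "good_rt (Node x [Node f ss, Node f' [Node g' []]])"
          by (rule good_permute_kid[OF m']) (rule good_listed, simp_all add: listed_simps)
      qed
    next
      case p: (2 us1 p p' vs1)
      then have "us1 @ p' # vs1 = [Node g []]" using s' by simp
      then have us1: "us1 = []" "vs1 = []" "leaf p'" by (auto simp: append_eq_Cons_conv)
      then obtain v k l where p': "p = Node v [Node k [], Node l []]"
        using prune_to_leaf[OF p(3)] by metis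
      show ?thesis
        by (rule good_permute[OF m b w], unfold s p(1) us1 p') (rule good_listed, simp_all add: listed_simps)
    qed
  qed
  then show ?thesis by (simp only: t)
qed

lemma good_rt_main:
  "wf_rt t \<Longrightarrow> \<not> star t \<Longrightarrow> \<not> bad t \<Longrightarrow> good_rt t"
proof (induction "length (labs t)" arbitrary: t rule: less_induct)
  case less
  have b: "below t" using less by (auto simp: below_def settled_def)
  show ?case
  proof (cases "twinfree t")
    case True
    then show ?thesis using good_twinfree b less by blast
  next
    case False
    then obtain t' where p: "prune t t'" using ex_prune by blast
    have "settled t'" using b prune_length[OF p] by (simp add: below_def)
    moreover have "wf_rt t'" using prune_graph[OF p] less.prems by blast
    ultimately consider "good_rt t'" | "star t'" | "bad t'" by (auto simp: settled_def)
    then show ?thesis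
      using good_prune good_prune_star good_prune_bad b p less.prems by cases blast+
  qed
qed

section \<open>From graphs to rooted trees\<close>

text \<open>Acyclicity is used in the form that every edge is a bridge, which is inherited by the two sides of
  a removed edge.\<close>

definition bridged :: "'a set \<Rightarrow> ('a \<times> 'a) set \<Rightarrow> bool" where
  "bridged V E \<longleftrightarrow> finite V \<and> E \<subseteq> V \<times> V \<and> sym E \<and> (\<forall>u\<in>V. \<forall>v\<in>V. (u, v) \<in> E\<^sup>*)
     \<and> (\<forall>u v. (u, v) \<in> E \<longrightarrow> (u, v) \<notin> (E - {(u, v), (v, u)})\<^sup>*)"

text \<open>\<open>A\<close> is the component of \<open>x\<close> in \<open>F\<close>. An edge stays
  a bridge because a detour around it inside the component would also be a detour in
  \<open>E\<close>.\<close>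

lemma bridged_part:
  assumes t: "bridged V E" and s: "sym F" and F: "F \<subseteq> E" and A: "A = {w. (x, w) \<in> F\<^sup>*}" "A \<subseteq> V"
  shows "bridged A (F \<inter> A \<times> A)"
proof -
  let ?G = "F \<inter> A \<times> A"
  have sG: "sym ?G" using s by (auto simp: sym_def)
  have r: "(x, w) \<in> ?G\<^sup>*" if "(x, w) \<in> F\<^sup>*" for w
    using that
  proof (induction rule: rtrancl_induct)
    case (step y z)
    then have "y \<in> A" "z \<in> A" using A rtrancl_into_rtrancl by fastforce+
    then show ?case using step by (meson IntI SigmaI rtrancl.rtrancl_into_rtrancl)
  qed simp
  have "(u, v) \<in> ?G\<^sup>*" if "u \<in> A" "v \<in> A" for u v
  proof -
    have "(x, u) \<in> ?G\<^sup>*" "(x, v) \<in> ?G\<^sup>*" using that A r by auto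
    then show ?thesis using sym_rtrancl[OF sG] by (meson rtrancl_trans symD)
  qed
  moreover have "(u, v) \<notin> (?G - {(u, v), (v, u)})\<^sup>*" if "(u, v) \<in> ?G" for u v
  proof -
    have "(u, v) \<notin> (E - {(u, v), (v, u)})\<^sup>*" using t that F by (auto simp: bridged_def)
    moreover have "?G - {(u, v), (v, u)} \<subseteq> E - {(u, v), (v, u)}" using F by blast
    ultimately show ?thesis using rtrancl_mono by blast
  qed
  moreover have "finite A" using t A finite_subset by (auto simp: bridged_def)
  ultimately show ?thesis using sG by (simp add: bridged_def)
qed

text \<open>Deleting an edge at \<open>x\<close> separates the components of \<open>x\<close> and of
  its other end \<open>y\<close>. Both become rooted trees by induction, and the second is hung onto
  the first as a new branch.\<close>

lemma bridged_rt:
  assumes "bridged V E" "x \<in> V"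
  shows "\<exists>t. wf_rt t \<and> verts t = V \<and> edges t = E \<and> root t = x"
  using assms
proof (induction "card V" arbitrary: V E x rule: less_induct)
  case less
  note t = less.prems(1)[unfolded bridged_def]
  show ?case
  proof (cases "V = {x}")
    case True
    have "(x, x) \<notin> E" using t by (metis rtrancl.rtrancl_refl)
    then have "E = {}" using t True by auto
    then show ?thesis using True by (intro exI[of _ "Node x []"]) simp
  next
    case False
    then obtain w where "w \<in> V" "w \<noteq> x" using less.prems by blast
    then have "(x, w) \<in> E\<^sup>*" using t less.prems(2) by blast
    then obtain y where xy: "(x, y) \<in> E" using \<open>w \<noteq> x\<close> by (auto elim: converse_rtranclE)
    have yV: "y \<in> V" using xy t by blast
    define F where "F = E - {(x, y), (y, x)}"
    define A where "A = {w. (x, w) \<in> F\<^sup>*}"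
    define B where "B = {w. (y, w) \<in> F\<^sup>*}"
    have FE: "F \<subseteq> E" and sF: "sym F" using t by (auto simp: F_def sym_def)
    have br: "(x, y) \<notin> F\<^sup>*" using t xy by (simp add: F_def)
    have disj: "A \<inter> B = {}"
      using br sym_rtrancl[OF sF] by (auto simp: A_def B_def) (meson rtrancl_trans symD)
    have stay: "w \<in> V" if "(u, w) \<in> F\<^sup>*" "u \<in> V" for u w
      using that by (induction rule: rtrancl_induct) (use t FE in blast)+
    have AV: "A \<subseteq> V" and BV: "B \<subseteq> V" using stay less.prems(2) yV by (auto simp: A_def B_def)
    have xA: "x \<in> A" and yB: "y \<in> B" by (simp_all add: A_def B_def)
    have "w \<in> A \<union> B" if "(x, w) \<in> E\<^sup>*" for w
      using that
    proof (induction rule: rtrancl_induct)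
      case base
      then show ?case using xA by simp
    next
      case (step u w)
      show ?case
      proof (cases "(u, w) \<in> F")
        case True
        then show ?thesis using step by (auto simp: A_def B_def intro: rtrancl_into_rtrancl)
      next
        case False
        then show ?thesis using step(2) xA yB by (auto simp: F_def)
      qed
    qed
    then have V: "V = A \<union> B" using AV BV t less.prems(2) by blast
    have step: "w \<in> A \<longleftrightarrow> u \<in> A" "w \<in> B \<longleftrightarrow> u \<in> B" if "(u, w) \<in> F" for u w
      using that symD[OF sF that] by (auto simp: A_def B_def intro: rtrancl_into_rtrancl)
    have "F \<subseteq> (F \<inter> A \<times> A) \<union> (F \<inter> B \<times> B)"
    proof
      fix e assume e: "e \<in> F"
      obtain u w where uw: "e = (u, w)" by (cases e)
      have "u \<in> A \<union> B" using e uw FE t V by blast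
      then show "e \<in> (F \<inter> A \<times> A) \<union> (F \<inter> B \<times> B)" using e uw step[of u w] by blast
    qed
    then have E: "E = (F \<inter> A \<times> A) \<union> (F \<inter> B \<times> B) \<union> {(x, y), (y, x)}"
      using xy t FE by (auto simp: F_def sym_def)
    have fin: "finite V" using t by blast
    have "A \<subset> V" "B \<subset> V" using disj xA yB AV BV less.prems(2) yV by blast+
    then have cA: "card A < card V" and cB: "card B < card V" using psubset_card_mono[OF fin] by blast+
    from less.hyps[OF cA bridged_part[OF less.prems(1) sF FE A_def AV] xA] obtain ta where
      ta: "wf_rt ta" "verts ta = A" "edges ta = F \<inter> A \<times> A" "root ta = x"
      by (elim exE conjE) (rule that)
    from less.hyps[OF cB bridged_part[OF less.prems(1) sF FE B_def BV] yB] obtain tb where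
      tb: "wf_rt tb" "verts tb = B" "edges tb = F \<inter> B \<times> B" "root tb = y"
      by (elim exE conjE) (rule that)
    obtain us where us: "ta = Node x us" using ta(4) by (cases ta) auto
    define rs where "rs = concat (map labs us)"
    have rs: "labs ta = x # rs" "labs (Node x (tb # us)) = x # labs tb @ rs" by (simp_all add: us rs_def)
    then have Ars: "A = insert x (set rs)" using ta(2) by simp
    have "x \<notin> B" "B \<inter> set rs = {}" using disj unfolding Ars by blast+
    then have "wf_rt (Node x (tb # us))" using ta(1) tb(1,2) unfolding rs by simp
    moreover have "verts (Node x (tb # us)) = V" unfolding rs V Ars using tb(2) by auto
    moreover have "edges (Node x (tb # us)) = {(x, y), (y, x)} \<union> edges tb \<union> edges ta"
      by (auto simp: us tb(4))
    then have "edges (Node x (tb # us)) = E" unfolding ta(3) tb(3) using E by blast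
    ultimately show ?thesis by (intro exI[of _ "Node x (tb # us)"]) simp
  qed
qed

section \<open>Walks, cycles and distances\<close>

lemma path_to_walk:
  assumes "(u, v) \<in> F\<^sup>*"
  shows "\<exists>p. p \<noteq> [] \<and> hd p = u \<and> last p = v \<and> distinct p \<and> (\<forall>i. Suc i < length p \<longrightarrow> (p ! i, p ! Suc i) \<in> F)"
  using assms
proof (induction rule: converse_rtrancl_induct)
  case base
  show ?case by (intro exI[of _ "[v]"]) simp
next
  case (step u w)
  then obtain p where p: "p \<noteq> []" "hd p = w" "last p = v" "distinct p"
    "\<forall>i. Suc i < length p \<longrightarrow> (p ! i, p ! Suc i) \<in> F" by blast
  show ?case
  proof (cases "u \<in> set p")
    case True
    \<comment> \<open>The path already visits \<open>u\<close>, so everything before that visit is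
      cut off.\<close>
    then obtain a b where ab: "p = a @ u # b" by (meson split_list)
    have "((u # b) ! i, (u # b) ! Suc i) \<in> F" if "Suc i < length (u # b)" for i
      using p(5)[rule_format, of "length a + i"] that by (simp add: ab nth_append)
    then show ?thesis using p ab by (intro exI[of _ "u # b"]) auto
  next
    case False
    have "((u # p) ! i, (u # p) ! Suc i) \<in> F" if "Suc i < length (u # p)" for i
      using p step(1) that by (cases i) (auto simp: hd_conv_nth)
    then show ?thesis using p False by (intro exI[of _ "u # p"]) auto
  qed
qed

lemma walk_rtrancl:
  assumes "is_walk V E p" shows "(hd p, last p) \<in> {(u, v). E u v}\<^sup>*"
  using assms
proof (induction p)
  case (Cons a p)
  show ?case
  proof (cases p)
    case (Cons b q)
    have i: "E ((a # p) ! i) ((a # p) ! Suc i)" if "Suc i < length (a # p)" for i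
      using Cons.prems that by (simp only: is_walk_def)
    have "E (p ! i) (p ! Suc i)" if "Suc i < length p" for i
      using i[of "Suc i"] that by simp
    then have "is_walk V E p" using Cons.prems Cons by (simp add: is_walk_def)
    moreover have "E a b" using i[of 0] Cons by simp
    ultimately show ?thesis using Cons.IH Cons by (auto intro: converse_rtrancl_into_rtrancl)
  qed simp
qed (simp add: is_walk_def)

text \<open>A simple path from \<open>u\<close> to \<open>v\<close> that avoids the edge between
  them closes up with this edge to a cycle.\<close>

lemma tree_bridged:
  assumes "is_tree V E" shows "bridged V {(u, v). E u v}"
proof -
  have g: "sgraph V E" "connected_graph V E" "\<nexists>p. is_cycle V E p"
    using assms by (auto simp: is_tree_def)
  have E: "E u v \<Longrightarrow> u \<in> V \<and> v \<in> V" "E u v \<Longrightarrow> E v u" "\<not> E u u" for u v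
    using g(1) unfolding sgraph_def by blast+
  have "(u, v) \<notin> ({(u, v). E u v} - {(u, v), (v, u)})\<^sup>*" if uv: "E u v" for u v
  proof
    assume "(u, v) \<in> ({(u, v). E u v} - {(u, v), (v, u)})\<^sup>*"
    from path_to_walk[OF this] obtain p where p: "p \<noteq> []" "hd p = u" "last p = v" "distinct p"
      "\<forall>i. Suc i < length p \<longrightarrow> (p ! i, p ! Suc i) \<in> {(u, v). E u v} - {(u, v), (v, u)}"
      by (elim exE conjE) (rule that)
    have "u \<noteq> v" using uv E by blast
    obtain a q where "p = a # q" using p(1) by (meson list.exhaust)
    moreover then obtain b r where "q = b # r" using p(2,3) \<open>u \<noteq> v\<close> by (cases q) auto
    ultimately have pq: "p = u # b # r" using p(2) by simp
    \<comment> \<open>A path with only two vertices would consist of the deleted edge.\<close>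
    then have "r \<noteq> []" using p(3) p(5)[rule_format, of 0] by auto
    then have len: "length p \<ge> 3" using pq by (cases r) auto
    have "\<exists>j. E (p ! i) (p ! j) \<or> E (p ! j) (p ! i)" if "i < length p" for i
    proof (cases i)
      case 0
      then show ?thesis using p(5)[rule_format, of 0] len by auto
    next
      case (Suc j)
      then show ?thesis using p(5)[rule_format, of j] that by auto
    qed
    then have "set p \<subseteq> V" using E(1) by (metis in_set_conv_nth subsetI)
    then have "is_cycle V E p"
      using p len E(2)[OF uv] by (auto simp: is_cycle_def is_walk_def)
    then show False using g(3) by blast
  qed
  moreover have "(u, v) \<in> {(u, v). E u v}\<^sup>*" if "u \<in> V" "v \<in> V" for u v
    using g(2) that walk_rtrancl[of V E] unfolding connected_graph_def by metis
  moreover have "finite V" using g(1) by (simp add: sgraph_def)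
  moreover have "{(u, v). E u v} \<subseteq> V \<times> V" "sym {(u, v). E u v}"
    using E(1,2) by (auto simp: sym_def)
  ultimately show ?thesis by (simp add: bridged_def)
qed

lemma near_walk:
  assumes "near {(u, v). E u v} k u v" "u \<in> V" and E: "\<And>u v. E u v \<Longrightarrow> v \<in> V"
  shows "\<exists>p. is_walk V E p \<and> hd p = u \<and> last p = v \<and> length p \<le> Suc k"
  using assms(1)
proof (induction k arbitrary: v)
  case 0
  then show ?case using assms(2) by (intro exI[of _ "[u]"]) (simp add: near_def is_walk_def)
next
  case (Suc k)
  then obtain w where w: "near {(u, v). E u v} k u w" "w = v \<or> E w v" by (auto simp: near_def)
  obtain p where p: "is_walk V E p" "hd p = u" "last p = w" "length p \<le> Suc k" using Suc.IH[OF w(1)] by blast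
  show ?case
  proof (cases "w = v")
    case True
    then show ?thesis using p by (intro exI[of _ p]) simp
  next
    case False
    then have wv: "E w v" using w by blast
    have ne: "p \<noteq> []" using p(1) by (simp add: is_walk_def)
    have "E ((p @ [v]) ! i) ((p @ [v]) ! Suc i)" if "Suc i < length (p @ [v])" for i
    proof (cases "Suc i < length p")
      case True
      then show ?thesis using p(1) by (simp add: is_walk_def nth_append)
    next
      case False
      then have "i = length p - 1" "i < length p" using that ne by auto
      then show ?thesis using wv p(3) ne by (simp add: nth_append last_conv_nth)
    qed
    then have "is_walk V E (p @ [v])" using p(1) E[OF wv] by (simp add: is_walk_def)
    then show ?thesis using p ne by (intro exI[of _ "p @ [v]"]) simp
  qed
qed

text \<open>\<open>near\<close> provides a walk, so the minimum in \<open>gdist\<close> is attained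
  and can be bounded. The second part excludes distance 0 for a moved vertex.\<close>

lemma near_gdist:
  assumes "near {(u, v). E u v} k u v" "u \<in> V" and E: "\<And>u v. E u v \<Longrightarrow> v \<in> V"
  shows "gdist V E u v \<le> k" "gdist V E u v = 0 \<Longrightarrow> u = v"
proof -
  let ?Q = "\<lambda>n. \<exists>p. is_walk V E p \<and> hd p = u \<and> last p = v \<and> length p = Suc n"
  obtain p where p: "is_walk V E p" "hd p = u" "last p = v" "length p \<le> Suc k"
    using near_walk[of E k u v V] assms by blast
  then have "p \<noteq> []" by (simp add: is_walk_def)
  then have q: "?Q (length p - 1)" using p by (intro exI[of _ p]) simp
  have "gdist V E u v \<le> length p - 1" unfolding gdist_def by (rule Least_le[of ?Q, OF q])
  then show "gdist V E u v \<le> k" using p(4) by simp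
  have "?Q (gdist V E u v)" unfolding gdist_def by (rule LeastI[of ?Q, OF q])
  then show "gdist V E u v = 0 \<Longrightarrow> u = v" by (auto simp: length_Suc_conv)
qed

lemma star_is_star:
  assumes "star t" "verts t = V" "edges t = {(u, v). E u v}"
  shows "is_star V E"
proof -
  have E: "E u v \<longleftrightarrow> (u, v) \<in> edges t" for u v using assms(3) by simp
  obtain x ts where t: "t = Node x ts" by (cases t)
  consider "\<forall>s\<in>set ts. leaf s" | c us where "ts = [Node c us]" "\<forall>s\<in>set us. leaf s"
    using assms(1) unfolding star_def t by (metis rt.collapse rt.sel(2))
  then show ?thesis
  proof cases
    case 1
    then obtain xs where xs: "ts = map (\<lambda>y. Node y []) xs" by (rule all_leafE)
    show ?thesis unfolding is_star_def E assms(2)[symmetric]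
      by (intro bexI[of _ x]) (auto simp: t xs)
  next
    case 2
    obtain xs where xs: "us = map (\<lambda>y. Node y []) xs" using 2(2) by (rule all_leafE)
    show ?thesis unfolding is_star_def E assms(2)[symmetric]
      by (intro bexI[of _ c]) (auto simp: t 2(1) xs)
  qed
qed

lemma bad_is_bad:
  assumes "bad t" "wf_rt t" "verts t = V" "edges t = {(u, v). E u v}"
  shows "bad_vertex V E (root t)"
proof -
  obtain x a b c d where t: "t = Node x [Node a [Node b []], Node c [Node d []]]"
    using assms(1) by (auto simp: bad_def)
  have dist: "distinct [b, a, x, c, d]" using assms(2) by (auto simp: t)
  have E: "E u v \<longleftrightarrow> (u, v) \<in> edges t" for u v using assms(4) by simp
  \<comment> \<open>The order along the path, which puts the root at index 2.\<close>
  define f where "f = (!) [b, a, x, c, d]"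
  have I: "{0..<5} = {0, 1, 2, 3, 4 :: nat}" by auto
  have f: "f 0 = b" "f 1 = a" "f 2 = x" "f 3 = c" "f 4 = d" by (simp_all add: f_def)
  have "bij_betw f {0..<5} V"
    unfolding bij_betw_def I using dist assms(3) f by (auto simp: t)
  moreover have "\<forall>i\<in>{0..<5}. \<forall>j\<in>{0..<5}. E (f i) (f j) \<longleftrightarrow> (i = Suc j \<or> j = Suc i)"
    unfolding I E using dist by (auto simp: f[simplified] t)
  ultimately show ?thesis unfolding bad_vertex_def using f(3) by (intro exI[of _ f]) (simp add: t)
qed

theorem theorem1p8:
  fixes V :: "'a set" and E :: "'a \<Rightarrow> 'a \<Rightarrow> bool" and x :: 'a
  assumes "is_tree V E"
    and "\<not> is_star V E"
    and "x \<in> V"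
    and "\<not> bad_vertex V E x"
  shows "\<exists>\<sigma>. good_two_placement V E x \<sigma>"
proof -
  let ?E = "{(u, v). E u v}"
  obtain t where t: "wf_rt t" "verts t = V" "edges t = ?E" "root t = x"
    using bridged_rt[OF tree_bridged[OF assms(1)] assms(3)] by blast
  have "\<not> star t" "\<not> bad t" using star_is_star bad_is_bad t assms by blast+
  then have "good V ?E x" using good_rt_main[OF t(1)] t by simp
  then obtain s where "places ?E V ?E (good_dem V ?E x) s" by (auto simp: good_def)
  note s = this[unfolded good_iff, simplified]
  have EV: "E u v \<Longrightarrow> v \<in> V" "E u v \<Longrightarrow> u \<in> V" for u v
    using assms(1) unfolding is_tree_def sgraph_def by blast+
  have d: "gdist V E u v \<le> k" "gdist V E u v = 0 \<Longrightarrow> u = v" if "near ?E k u v" "u \<in> V" for k u v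
    using near_gdist[OF that] EV(1) by metis+
  have sV: "s u \<in> V" if "u \<in> V" for u using s that bij_betw_apply by metis
  have fp: "s u \<noteq> u" if "u \<in> V" for u using s that by blast
  have "gdist V E (s a) (s b) \<le> 5" if "E a b" for a b
    using d(1)[of 5 "s a" "s b"] s that sV[OF EV(2)[OF that]] by blast
  \<comment> \<open>The distance is at most 1, and not 0 because \<open>x\<close> is moved.\<close>
  moreover have "gdist V E x (s x) = 1"
    using d[of "Suc 0" x "s x"] s fp[OF assms(3)] assms(3) by fastforce
  moreover have "gdist V E y (s y) \<le> 2" if "E x y" for y
    using d(1)[of 2 y "s y"] s that EV(1)[OF that] by blast
  moreover have "gdist V E y (s y) \<le> 4" if "y \<in> V" for y
    using d(1)[of 4 y "s y"] s that by blast
  ultimately show ?thesis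
    unfolding good_two_placement_def two_placement_def using s fp by (intro exI[of _ s]) auto
qed

end
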